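(* Let $K\le 0$ and $n\ge 1$ be real numbers and let $X$ be a locally Busemann space satisfying the local non-collapsed $\mathrm{MCP}(K,n)$ condition. Let $p\in X$ be a manifold point. Then, for any $0<\epsilon<1$, there exists $R>0$ such that the exponential map $$\exp_p:B(o,R)\to B(p,R)$$ is an $\epsilon$-almost isometry, where $o$ denotes the apex of the tangent cone $T_pX$.
   Context: A shortest path is an isometric embedding of an interval into a metric space. A geodesic space is a metric space in which every two points can be joined by a shortest path; it is uniquely geodesic if the shortest path between any two given points is unique. A subset $A$ is convex if for all $x,y\in A$ every shortest path connecting $x$ and $y$ is contained in $A$. $B(p,r)$ is the open $r$-ball. In a uniquely geodesic space $(X,d)$, for $p,x\in X$ and $0\le t\le 1$ the $t$-intermediate point $x_t$ for $x$ with respect to $p$ is the point on the shortest path from $p$ to $x$ with $d(p,x_t)=t\,d(p,x)$. For $A\subset X$, $A_t:=\{x_t\mid x\in A\}$. A Busemann space is a complete uniquely geodesic space $X$ such that for every $p\in X$, all $x,y\in X$ and $0\le t\le 1$, $d(x_t,y_t)\le t\,d(x,y)$ (intermediate points with respect to $p$). A locally Busemann space is a complete geodesic space in which every point has a neighborhood that is a Busemann space with respect to the restricted metric. A metric measure space $(X,d,m)$ is a complete separable geodesic space with a locally finite, locally positive Borel measure $m$. A uniquely geodesic metric measure space satisfies $\mathrm{MCP}(K,N)$ ($K\le 0$, $N\ge1$) if for every $p\in X$, every measurable $A\subset X$ with $0<m(A)<\infty$ and every $0\le t\le 1$ (with $A_t$ taken with respect to $p$): when $K=0$, $m(A_t)\ge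 t^N m(A)$; when $K<0$ and $N>1$, $$m(A_t)\ge\int_A t\left(\frac{\sinh\left(t\,d(p,x)\sqrt{-K/(N-1)}\right)}{\sinh\left(d(p,x)\sqrt{-K/(N-1)}\right)}\right)^{N-1}dm(x);$$ when $K<0$ and $N=1$ the factor raised to the power $N-1$ is read as $1$. A space satisfies the local $\mathrm{MCP}(K,N)$ if every point has a convex neighborhood (uniquely geodesic in the present setting) that satisfies $\mathrm{MCP}(K,N)$ with respect to the restricted metric and measure. It satisfies local non-collapsed $\mathrm{MCP}(K,n)$ if this holds with $m=\mathcal{H}^n$, the $n$-dimensional Hausdorff measure. A manifold point is a point having a neighborhood homeomorphic to a Euclidean space. Tangent cone: let $\Gamma_p$ be the set of (unit speed) shortest paths emanating from $p$. On $\Gamma_p\times[0,\infty)$ define the pseudo-metric $d^*((\gamma,a),(\eta,b)):=\lim_{t\to0}d(\gamma(at),\eta(bt))/t$ (the limit exists by the Busemann convexity). The completion of the associated metric space is the geodesic tangent cone $T_p^gX$; its apex $o$ is the class of $(\gamma,0)$. At a manifold point $p$ of a locally Busemann space $X$ satisfying local non-collapsed $\mathrm{MCP}(K,n)$ with $K\le 0$ and $n\ge 1$, $X$ has no branching geodesics near $p$, shortest paths from $p$ extend to a uniform length, and $T_p^gX$ is isometric to the unique Gromov–Hausdorff tangent cone $T_pX$ (the pointed Gromov–Hausdorff limit of $(\lambda X,p)$ as $\lambda\to\infty$), so one writes $T_pX=T_p^gX$. Exponential map: for sufficiently small $r>0$, $\exp_p:B(o,r)\subset T_p^gX\to B(p,r)$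 is the well-defined map $\exp_p((\gamma,t)):=\gamma(t)$, where points of $B(o,r)$ are represented by pairs $(\gamma,t)$ with $\gamma$ defined on $[0,t]$. For $0<\epsilon<1$, a map $f:(Y,d_Y)\to(Z,d_Z)$ between metric spaces is an $\epsilon$-almost isometry if it is surjective and $\left|\frac{d_Z(f(y),f(y'))}{d_Y(y,y')}-1\right|\le\epsilon$ for all $y\ne y'$ in $Y$. *)

theory Defs
  imports "HOL-Analysis.Analysis"
begin

section \<open>Geodesic spaces\<close>

text \<open>
  The ambient space is a type of class \<open>metric_space\<close>.  A subset \<open>S\<close> stands for the metric space
  \<open>S\<close> with the restricted metric; the whole space is \<open>UNIV\<close>.
\<close>

definition shortest_path :: "'a::metric_space set \<Rightarrow> real \<Rightarrow> (real \<Rightarrow> 'a) \<Rightarrow> bool" where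
  "shortest_path S l \<gamma> \<longleftrightarrow>
     0 \<le> l \<and> \<gamma> ` {0..l} \<subseteq> S \<and> (\<forall>s\<in>{0..l}. \<forall>t\<in>{0..l}. dist (\<gamma> s) (\<gamma> t) = \<bar>s - t\<bar>)"

text \<open>
  A shortest path from \<open>x\<close> to \<open>y\<close> is necessarily parametrized (from \<open>0\<close>) by \<open>{0..dist x y}\<close>;
  the values of \<open>\<gamma>\<close> outside this interval carry no meaning.
\<close>

definition shortest_path_from_to :: "'a::metric_space set \<Rightarrow> 'a \<Rightarrow> 'a \<Rightarrow> (real \<Rightarrow> 'a) \<Rightarrow> bool" where
  "shortest_path_from_to S x y \<gamma> \<longleftrightarrow>
     shortest_path S (dist x y) \<gamma> \<and> \<gamma> 0 = x \<and> \<gamma> (dist x y) = y"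

definition geodesic_space :: "'a::metric_space set \<Rightarrow> bool" where
  "geodesic_space S \<longleftrightarrow> (\<forall>x\<in>S. \<forall>y\<in>S. \<exists>\<gamma>. shortest_path_from_to S x y \<gamma>)"

definition uniquely_geodesic_space :: "'a::metric_space set \<Rightarrow> bool" where
  "uniquely_geodesic_space S \<longleftrightarrow> geodesic_space S \<and>
     (\<forall>x\<in>S. \<forall>y\<in>S. \<forall>\<gamma> \<eta>. shortest_path_from_to S x y \<gamma> \<and> shortest_path_from_to S x y \<eta> \<longrightarrow>
        (\<forall>s\<in>{0..dist x y}. \<gamma> s = \<eta> s))"

definition geodesically_convex :: "'a::metric_space set \<Rightarrow> bool" where
  "geodesically_convex A \<longleftrightarrow>
     (\<forall>x\<in>A. \<forall>y\<in>A. \<forall>\<gamma>. shortest_path_from_to UNIV x y \<gamma> \<longrightarrow> \<gamma> ` {0..dist x y} \<subseteq> A)"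

definition intermediate_point :: "'a::metric_space set \<Rightarrow> 'a \<Rightarrow> real \<Rightarrow> 'a \<Rightarrow> 'a" where
  "intermediate_point S p t x =
     (THE y. \<exists>\<gamma>. shortest_path_from_to S p x \<gamma> \<and> y \<in> \<gamma> ` {0..dist p x} \<and> dist p y = t * dist p x)"

section \<open>Busemann spaces\<close>

definition busemann_space :: "'a::metric_space set \<Rightarrow> bool" where
  "busemann_space S \<longleftrightarrow> complete S \<and> uniquely_geodesic_space S \<and>
     (\<forall>p\<in>S. \<forall>x\<in>S. \<forall>y\<in>S. \<forall>t\<in>{0..1}.
        dist (intermediate_point S p t x) (intermediate_point S p t y) \<le> t * dist x y)"

definition locally_busemann_space :: "'a::metric_space itself \<Rightarrow> bool" where
  "locally_busemann_space _ \<longleftrightarrow> complete (UNIV :: 'a set) \<and> geodesic_space (UNIV :: 'a set) \<and>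
     (\<forall>x::'a. \<exists>U. x \<in> interior U \<and> busemann_space U)"

section \<open>Hausdorff measure\<close>

text \<open>
  The normalization by \<open>unit_ball_vol s / 2 powr s\<close> makes the measure agree with Lebesgue measure
  on Euclidean space of dimension \<open>s\<close>.  The definition is meant for \<open>s > 0\<close>, since
  \<open>0 powr 0 = 0\<close>.
\<close>

definition hausdorff_content :: "real \<Rightarrow> real \<Rightarrow> 'a::metric_space set \<Rightarrow> ennreal" where
  "hausdorff_content s \<delta> A =
     (INF C \<in> {C :: nat \<Rightarrow> 'a set. A \<subseteq> (\<Union>i. C i) \<and> (\<forall>i. bounded (C i) \<and> diameter (C i) \<le> \<delta>)}.
        \<Sum>i. ennreal (unit_ball_vol s / 2 powr s * diameter (C i) powr s))"

definition hausdorff_outer :: "real \<Rightarrow> 'a::metric_space set \<Rightarrow> ennreal" where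
  "hausdorff_outer s A = (SUP \<delta>\<in>{0<..}. hausdorff_content s \<delta> A)"

definition hausdorff_measure :: "real \<Rightarrow> 'a::metric_space measure" where
  "hausdorff_measure s = measure_of UNIV (sets borel) (hausdorff_outer s)"

lemma space_hausdorff_measure [simp]: "space (hausdorff_measure s) = UNIV"
  by (simp add: hausdorff_measure_def space_measure_of_conv)

lemma sets_hausdorff_measure [simp]: "sets (hausdorff_measure s) = sets borel"
  unfolding hausdorff_measure_def
  by (metis sets.sigma_sets_eq sets.space_closed sets_measure_of space_borel)

text \<open>The Hausdorff outer measure is countably additive on Borel sets, by Caratheodory's criterion.\<close>

lemma hausdorff_content_mono: "A \<subseteq> B \<Longrightarrow> hausdorff_content s \<delta> A \<le> hausdorff_content s \<delta> B"
  unfolding hausdorff_content_def by (rule INF_superset_mono) auto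

lemma hausdorff_content_antimono: "\<delta> \<le> \<epsilon> \<Longrightarrow> hausdorff_content s \<epsilon> A \<le> hausdorff_content s \<delta> A"
  unfolding hausdorff_content_def by (rule INF_superset_mono) (auto intro: order_trans)

lemma hausdorff_outer_mono: "A \<subseteq> B \<Longrightarrow> hausdorff_outer s A \<le> hausdorff_outer s B"
  unfolding hausdorff_outer_def by (rule SUP_mono) (auto intro: hausdorff_content_mono)

lemma hausdorff_outer_empty [simp]: "hausdorff_outer s {} = 0"
proof -
  have "hausdorff_content s \<delta> ({}::'a set) \<le> 0" if "0 < \<delta>" for \<delta>
    unfolding hausdorff_content_def by (rule INF_lower2[of "\<lambda>_. {}"]) (use that in auto)
  then have "hausdorff_outer s ({}::'a set) \<le> 0"
    unfolding hausdorff_outer_def by (intro SUP_least) auto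
  then show ?thesis by simp
qed

lemma hausdorff_content_UN:
  fixes A :: "nat \<Rightarrow> 'a::metric_space set"
  shows "hausdorff_content s \<delta> (\<Union>n. A n) \<le> (\<Sum>n. hausdorff_content s \<delta> (A n))"
proof (rule ennreal_le_epsilon)
  let ?H = "hausdorff_content s \<delta>"
  let ?g = "\<lambda>C::'a set. ennreal (unit_ball_vol s / 2 powr s * diameter C powr s)"
  fix e :: real assume e: "0 < e" "(\<Sum>n. ?H (A n)) < top"
  then have *: "\<And>n. ?H (A n) < ?H (A n) + e * (1/2)^Suc n"
    by (auto simp add: less_top dest!: ennreal_suminf_lessD)
  have "\<exists>C. A n \<subseteq> (\<Union>i. C i) \<and> (\<forall>i. bounded (C i) \<and> diameter (C i) \<le> \<delta>) \<and>
           (\<Sum>i. ?g (C i)) < ?H (A n) + e * (1/2)^Suc n" for n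
    using *[of n] unfolding hausdorff_content_def[of s \<delta> "A n"] INF_less_iff by (auto simp: conj_assoc)
  then obtain B where B: "\<And>n. A n \<subseteq> (\<Union>i. B n i)"
      "\<And>n i. bounded (B n i)" "\<And>n i. diameter (B n i) \<le> \<delta>"
      "\<And>n. (\<Sum>i. ?g (B n i)) < ?H (A n) + e * (1/2)^Suc n" by metis
  define C where "C = case_prod B o prod_decode"
  have A_C: "(\<Union>i. A i) \<subseteq> (\<Union>i. C i)"
    using B(1) by (auto simp add: C_def subset_eq) (metis prod.case prod_encode_inverse)
  have "?H (\<Union>i. A i) \<le> (\<Sum>i. ?g (C i))"
    unfolding hausdorff_content_def
    by (rule INF_lower2[of C]) (use A_C in \<open>auto simp: C_def B split: prod.splits\<close>)
  also have "\<dots> = (\<Sum>n. \<Sum>i. ?g (B n i))"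
    using suminf_ennreal_2dimen[of "\<lambda>n. \<Sum>i. ?g (B n i)" "\<lambda>p. ?g (case_prod B p)"]
    by (simp add: C_def comp_def)
  also have "\<dots> \<le> (\<Sum>n. ?H (A n) + e * (1/2) ^ Suc n)"
    by (intro suminf_le allI less_imp_le B) auto
  also have "... = (\<Sum>n. ?H (A n)) + (\<Sum>n. ennreal e * ennreal ((1/2) ^ Suc n))"
    using \<open>0 < e\<close> by (subst suminf_add[symmetric])
                     (auto simp del: ennreal_suminf_cmult simp add: ennreal_mult[symmetric])
  also have "\<dots> = (\<Sum>n. ?H (A n)) + e"
    unfolding ennreal_suminf_cmult
    by (subst suminf_ennreal_eq[OF zero_le_power power_half_series]) auto
  finally show "?H (\<Union>i. A i) \<le> (\<Sum>n. ?H (A n)) + e" .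
qed

lemma hausdorff_content_le_outer: "0 < \<delta> \<Longrightarrow> hausdorff_content s \<delta> A \<le> hausdorff_outer s A"
  unfolding hausdorff_outer_def by (rule SUP_upper) auto

lemma hausdorff_outer_UN: "hausdorff_outer s (\<Union>n::nat. A n) \<le> (\<Sum>n. hausdorff_outer s (A n))"
  unfolding hausdorff_outer_def[of s "\<Union>n. A n"]
proof (rule SUP_least)
  fix \<delta> :: real assume "\<delta> \<in> {0<..}"
  have "hausdorff_content s \<delta> (\<Union>n. A n) \<le> (\<Sum>n. hausdorff_content s \<delta> (A n))"
    by (rule hausdorff_content_UN)
  also have "\<dots> \<le> (\<Sum>n. hausdorff_outer s (A n))"
    by (intro suminf_le hausdorff_content_le_outer) (use \<open>\<delta> \<in> _\<close> in auto)
  finally show "hausdorff_content s \<delta> (\<Union>n. A n) \<le> (\<Sum>n. hausdorff_outer s (A n))" .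
qed

lemma outer_measure_space_hausdorff: "outer_measure_space UNIV (hausdorff_outer s)"
  by (auto simp: outer_measure_space_def positive_def increasing_def countably_subadditive_def
      intro: hausdorff_outer_mono hausdorff_outer_UN)

lemma hausdorff_outer_Un: "hausdorff_outer s (A \<union> B) \<le> hausdorff_outer s A + hausdorff_outer s B"
proof -
  interpret sigma_algebra UNIV UNIV using sigma_algebra_Pow[of UNIV] by simp
  have "subadditive UNIV (hausdorff_outer s)"
    using outer_measure_space_hausdorff[of s] unfolding outer_measure_space_def
    by (metis countably_subadditive_subadditive)
  then have "hausdorff_outer s (A \<union> (B - A)) \<le> hausdorff_outer s A + hausdorff_outer s (B - A)"
    unfolding subadditive_def by blast
  also have "\<dots> \<le> hausdorff_outer s A + hausdorff_outer s B"
    by (intro add_left_mono hausdorff_outer_mono) auto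
  finally show ?thesis by simp
qed

lemma hausdorff_outer_separated:
  assumes e: "0 < e" "\<And>x y. x \<in> A \<Longrightarrow> y \<in> B \<Longrightarrow> e \<le> dist x y"
  shows "hausdorff_outer s A + hausdorff_outer s B \<le> hausdorff_outer s (A \<union> B)"
proof -
  let ?g = "\<lambda>C::'a set. ennreal (unit_ball_vol s / 2 powr s * diameter C powr s)"
  have *: "hausdorff_content s \<delta> A + hausdorff_content s \<delta> B \<le> hausdorff_content s \<delta> (A \<union> B)"
    if "0 < \<delta>" "\<delta> < e" for \<delta>
    unfolding hausdorff_content_def[of s \<delta> "A \<union> B"]
  proof (rule INF_greatest, safe)
    fix C assume C: "A \<union> B \<subseteq> (\<Union>i::nat. C i)" "\<forall>i. bounded (C i) \<and> diameter (C i) \<le> \<delta>"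
    define P where "P X i = (if C i \<inter> X \<noteq> {} then C i else {})" for X i
    have "hausdorff_content s \<delta> X \<le> (\<Sum>i. ?g (P X i))" if "X \<subseteq> A \<union> B" for X
      unfolding hausdorff_content_def
      by (rule INF_lower2[of "P X"])
        (use that C \<open>0 < \<delta>\<close> in \<open>auto simp: P_def subset_eq\<close>, (metis UN_E UnI1 UnI2 disjoint_iff)?)
    then have "hausdorff_content s \<delta> A + hausdorff_content s \<delta> B
        \<le> (\<Sum>i. ?g (P A i)) + (\<Sum>i. ?g (P B i))" by (intro add_mono) auto
    also have "\<dots> = (\<Sum>i. ?g (P A i) + ?g (P B i))" by (rule suminf_add) auto
    also have "\<dots> \<le> (\<Sum>i. ?g (C i))"
    proof (intro suminf_le)
      fix i
      have "C i \<inter> A = {} \<or> C i \<inter> B = {}"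
      proof (rule ccontr)
        assume "\<not> ?thesis"
        then obtain x y where "x \<in> C i" "x \<in> A" "y \<in> C i" "y \<in> B" by auto
        moreover then have "dist x y \<le> diameter (C i)"
          using C(2) by (intro diameter_bounded_bound) auto
        ultimately show False using e(2)[of x y] C(2) \<open>\<delta> < e\<close> by (meson leD order_trans order_le_less_trans)
      qed
      then show "?g (P A i) + ?g (P B i) \<le> ?g (C i)" by (auto simp: P_def)
    qed auto
    finally show "hausdorff_content s \<delta> A + hausdorff_content s \<delta> B \<le> (\<Sum>i. ?g (C i))" .
  qed
  have le: "hausdorff_outer s X \<le> (SUP \<delta>\<in>{0<..<e}. hausdorff_content s \<delta> X)" for X :: "'a set"
    unfolding hausdorff_outer_def
  proof (rule SUP_mono)
    fix \<delta> :: real assume "\<delta> \<in> {0<..}"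
    then show "\<exists>m\<in>{0<..<e}. hausdorff_content s \<delta> X \<le> hausdorff_content s m X"
      using e(1) by (intro bexI[of _ "min \<delta> (e/2)"] hausdorff_content_antimono) auto
  qed
  have "hausdorff_outer s A + hausdorff_outer s B
    \<le> (SUP \<delta>\<in>{0<..<e}. hausdorff_content s \<delta> A) + (SUP \<delta>\<in>{0<..<e}. hausdorff_content s \<delta> B)"
    by (intro add_mono le)
  also have "\<dots> = (SUP \<delta>\<in>{0<..<e}. hausdorff_content s \<delta> A + hausdorff_content s \<delta> B)"
  proof (rule SUP_add_directed_ennreal[symmetric])
    fix i j assume "i \<in> {0<..<e}" "j \<in> {0<..<e}"
    then show "\<exists>k\<in>{0<..<e}. hausdorff_content s i A + hausdorff_content s j B
       \<le> hausdorff_content s k A + hausdorff_content s k B"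
      by (intro bexI[of _ "min i j"] add_mono hausdorff_content_antimono) auto
  qed
  also have "\<dots> \<le> hausdorff_outer s (A \<union> B)"
    by (rule SUP_least) (meson "*" greaterThanLessThan_iff hausdorff_content_le_outer order_trans)
  finally show ?thesis .
qed

lemma hausdorff_outer_closed:
  fixes F :: "'a::metric_space set"
  assumes "closed F"
  shows "hausdorff_outer s (A \<inter> F) + hausdorff_outer s (A - F) \<le> hausdorff_outer s A"
proof (cases "F = {} \<or> hausdorff_outer s A = top")
  case True then show ?thesis by auto
next
  case False
  let ?H = "hausdorff_outer s :: 'a set \<Rightarrow> ennreal"
  define D where "D n = {x \<in> A. 1 / real (Suc n) \<le> infdist x F}" for n
  define R where "R n = D (Suc n) - D n" for n
  have fin: "?H A < top" using False by (simp add: less_top)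
  have infd: "infdist x F \<le> dist x y" if "y \<in> F" for x y using that by (rule infdist_le)
  have D_mono: "D m \<subseteq> D n" if "m \<le> n" for m n
    unfolding D_def using that
    by (auto intro: order_trans[rotated] simp: frac_le)
  have D_UN: "A - F = (\<Union>n. D n)"
  proof (safe)
    fix x assume x: "x \<in> A" "x \<notin> F"
    then have "0 < infdist x F"
      using assms False infdist_pos_not_in_closed by blast
    then obtain n where "1 / real (Suc n) < infdist x F" using nat_approx_posE by blast
    with x show "x \<in> (\<Union>n. D n)" by (auto simp: D_def intro!: exI[of _ n])
  next
    fix x n assume "x \<in> D n" then show "x \<in> A" by (simp add: D_def)
  next
    fix x n assume "x \<in> D n" "x \<in> F" then show False
      by (simp add: D_def)
  qed
  have sep: "dist x y \<ge> 1 / real (Suc m) - 1 / real (Suc n)" if "x \<in> D m" "y \<in> A" "y \<notin> D n" for x y m n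
  proof -
    have "infdist x F \<le> infdist y F + dist x y" by (rule infdist_triangle)
    then show ?thesis using that by (auto simp: D_def)
  qed
  have sep': "dist x y \<ge> 1 / (real (Suc m) * real (Suc (Suc m)))" if "x \<in> D m" "y \<in> A" "y \<notin> D (Suc m)" for x y m
    using sep[OF that] by (simp add: field_simps)
  have step: "?H (D m) + ?H X \<le> ?H (D m \<union> X)" if "X \<subseteq> A" "X \<inter> D (Suc m) = {}" for m X
    by (rule hausdorff_outer_separated[of "1 / (real (Suc m) * real (Suc (Suc m)))"])
      (use that sep'[of _ m] in auto)
  have D_A: "D m \<subseteq> A" for m by (auto simp: D_def)
  have alt: "(\<Sum>i<k. ?H (R (Suc (2*i + j)))) \<le> ?H (D (2*k + j))" for k j :: nat
  proof (induction k)
    case (Suc k)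
    have "(\<Sum>i<Suc k. ?H (R (Suc (2*i + j)))) \<le> ?H (D (2*k+j)) + ?H (R (Suc (2*k+j)))"
      using Suc by (simp add: add_right_mono)
    also have "\<dots> \<le> ?H (D (2*k+j) \<union> R (Suc (2*k+j)))"
      using D_A by (intro step) (auto simp: R_def)
    also have "\<dots> \<le> ?H (D (2 * Suc k + j))"
      using D_mono[of "2*k+j" "2 * Suc k + j"] by (intro hausdorff_outer_mono) (auto simp: R_def)
    finally show ?case .
  qed simp
  define r where "r i = ?H (R (Suc i))" for i
  have sum_r: "(\<Sum>i<2*k. r i) = (\<Sum>i<k. r (2*i)) + (\<Sum>i<k. r (2*i+1))" for k
    by (induction k) (simp_all add: ac_simps)
  have "(\<Sum>i<k. r i) \<le> ?H A + ?H A" for k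
  proof -
    have "(\<Sum>i<k. r i) \<le> (\<Sum>i<2*k. r i)" by (rule sum_mono2) auto
    also have "\<dots> \<le> ?H (D (2*k)) + ?H (D (2*k+1))"
      unfolding sum_r using alt[where k=k and j=0] alt[where k=k and j=1]
      by (intro add_mono) (auto simp: r_def)
    also have "\<dots> \<le> ?H A + ?H A"
      using D_A by (intro add_mono hausdorff_outer_mono) auto
    finally show ?thesis .
  qed
  then have "suminf r \<le> ?H A + ?H A" by (intro suminf_le_const summableI)
  then have S: "suminf r < top" using fin by (auto simp: less_top top_unique intro: le_less_trans)
  show ?thesis
  proof (rule ennreal_le_epsilon)
    fix e :: real assume "0 < e"
    have "(\<lambda>n. (\<Sum>i<n. r i) + ennreal e) \<longlonglongrightarrow> suminf r + ennreal e"
      by (intro tendsto_add summable_LIMSEQ summableI tendsto_const)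
    moreover have "suminf r < suminf r + ennreal e"
      using S \<open>0 < e\<close> by (simp add: ennreal_add_left_cancel_less less_top)
    ultimately have "\<forall>\<^sub>F n in sequentially. suminf r < (\<Sum>i<n. r i) + ennreal e"
      by (rule order_tendstoD)
    then obtain n where n: "suminf r < (\<Sum>i<n. r i) + ennreal e"
      by (auto dest: eventually_happens)
    have fin_n: "(\<Sum>i<n. r i) < top"
      by (rule le_less_trans[OF sum_le_suminf S]) auto
    have "suminf r = (\<Sum>i. r (i + n)) + (\<Sum>i<n. r i)"
      by (rule suminf_offset) auto
    with n fin_n have tail: "(\<Sum>i. r (i + n)) \<le> e"
      by (metis add.commute ennreal_add_left_cancel_less less_imp_le)
    have "A - F \<subseteq> D (Suc n) \<union> (\<Union>i. R (Suc (i + n)))"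
    proof
      fix x assume "x \<in> A - F"
      then obtain k where "x \<in> D k" using D_UN by auto
      then show "x \<in> D (Suc n) \<union> (\<Union>i. R (Suc (i + n)))"
      proof (induction k)
        case 0 then show ?case using D_mono[of 0 "Suc n"] by auto
      next
        case (Suc k)
        show ?case
        proof (cases "x \<in> D k \<or> Suc k \<le> Suc n")
          case True then show ?thesis using Suc D_mono[of "Suc k" "Suc n"] by auto
        next
          case False
          then have "x \<in> R (Suc ((k - Suc n) + n))" using Suc.prems by (auto simp: R_def)
          then show ?thesis by blast
        qed
      qed
    qed
    then have "?H (A - F) \<le> ?H (D (Suc n)) + ?H (\<Union>i. R (Suc (i + n)))"
      by (meson hausdorff_outer_Un hausdorff_outer_mono order_trans)
    also have "\<dots> \<le> ?H (D (Suc n)) + e"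
      using hausdorff_outer_UN[of s "\<lambda>i. R (Suc (i + n))"] tail
      by (intro add_left_mono) (auto simp: r_def)
    finally have "?H (A \<inter> F) + ?H (A - F) \<le> ?H (A \<inter> F) + (?H (D (Suc n)) + e)"
      by (rule add_left_mono)
    also have "?H (A \<inter> F) + (?H (D (Suc n)) + e) = (?H (D (Suc n)) + ?H (A \<inter> F)) + e"
      by (simp add: ac_simps)
    also have "?H (D (Suc n)) + ?H (A \<inter> F) \<le> ?H (D (Suc n) \<union> (A \<inter> F))"
    proof (rule hausdorff_outer_separated[of "1 / real (Suc (Suc n))"])
      fix x y assume "x \<in> D (Suc n)" "y \<in> A \<inter> F"
      then show "1 / real (Suc (Suc n)) \<le> dist x y"
        using infd[of y x] by (auto simp: D_def)
    qed simp
    also have "\<dots> \<le> ?H A" using D_A by (intro hausdorff_outer_mono) auto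
    finally show "?H (A \<inter> F) + ?H (A - F) \<le> ?H A + e"
      by (simp add: add_right_mono)
  qed
qed

lemma emeasure_hausdorff_measure:
  assumes "A \<in> sets borel"
  shows "emeasure (hausdorff_measure s) A = hausdorff_outer s A"
proof -
  let ?H = "hausdorff_outer s :: 'a set \<Rightarrow> ennreal"
  let ?L = "lambda_system UNIV UNIV ?H"
  interpret sigma_algebra UNIV "UNIV :: 'a set set" using sigma_algebra_Pow[of UNIV] by simp
  have L: "measure_space UNIV ?L ?H"
    by (rule caratheodory_lemma[OF outer_measure_space_hausdorff])
  then have sa: "sigma_algebra UNIV ?L" by (simp add: measure_space_def)
  have "F \<in> ?L" if "closed F" for F
    unfolding lambda_system_eq
    using hausdorff_outer_closed[OF that, of s] hausdorff_outer_Un[of s "X \<inter> F" "X - F" for X]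
    by (auto intro!: antisym simp: Int_Diff_Un)
  then have "sigma_sets UNIV (Collect closed) \<subseteq> ?L"
    by (intro sigma_algebra.sigma_sets_subset[OF sa]) auto
  then have bL: "sets borel \<subseteq> ?L" by (simp add: borel_eq_closed)
  have "measure_space UNIV (sets borel) ?H"
    using L bL sets.sigma_algebra_axioms[of borel]
    by (auto simp: measure_space_def positive_def countably_additive_def)
  then show ?thesis
    using assms unfolding hausdorff_measure_def
    by (intro emeasure_measure_of_sigma) (auto simp: measure_space_def)
qed

section \<open>The measure contraction property\<close>

text \<open>
  A metric measure space is given by its measure; the underlying set is the space of the measure.
\<close>

definition metric_measure_space :: "'a::metric_space measure \<Rightarrow> bool" where
  "metric_measure_space m \<longleftrightarrow>
     complete (space m) \<and> separable_space (top_of_set (space m)) \<and> geodesic_space (space m) \<and>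
     sets m = sets (restrict_space borel (space m)) \<and>
     (\<forall>x\<in>space m. \<exists>U. openin (top_of_set (space m)) U \<and> x \<in> U \<and> emeasure m U < \<infinity>) \<and>
     (\<forall>U. openin (top_of_set (space m)) U \<and> U \<noteq> {} \<longrightarrow> 0 < emeasure m U)"

text \<open>
  The factor \<open>t (sinh (t d \<kappa>) / sinh (d \<kappa>)) powr (N - 1)\<close> with \<open>\<kappa> = sqrt (- K / (N - 1))\<close>, where
  the quotient is read as \<open>1\<close> to the power \<open>N - 1\<close> if \<open>N = 1\<close>, and is continued by its limit \<open>t\<close>
  at \<open>d = 0\<close>.
\<close>

definition mcp_factor :: "real \<Rightarrow> real \<Rightarrow> real \<Rightarrow> real \<Rightarrow> real" where
  "mcp_factor K N t d =
     (if N = 1 then t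
      else if d = 0 then t * t powr (N - 1)
      else t * (sinh (t * d * sqrt (- K / (N - 1))) / sinh (d * sqrt (- K / (N - 1)))) powr (N - 1))"

text \<open>
  The contracted set \<open>A\<^sub>t\<close> need not be a Borel set, so its measure is taken with respect to the
  outer measure induced by \<open>m\<close>; this agrees with \<open>m\<close> (and its completion) on measurable sets.
\<close>

definition mcp :: "real \<Rightarrow> real \<Rightarrow> 'a::metric_space measure \<Rightarrow> bool" where
  "mcp K N m \<longleftrightarrow>
     K \<le> 0 \<and> 1 \<le> N \<and> metric_measure_space m \<and> uniquely_geodesic_space (space m) \<and>
     (\<forall>p\<in>space m. \<forall>A\<in>sets m. \<forall>t\<in>{0..1}. 0 < emeasure m A \<and> emeasure m A < \<infinity> \<longrightarrow>
        (if K = 0 then ennreal (t powr N) * emeasure m A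
         else \<integral>\<^sup>+x\<in>A. ennreal (mcp_factor K N t (dist p x)) \<partial>m)
        \<le> outer_measure_of m (intermediate_point (space m) p t ` A))"

definition local_mcp :: "real \<Rightarrow> real \<Rightarrow> 'a::metric_space measure \<Rightarrow> bool" where
  "local_mcp K N m \<longleftrightarrow>
     (\<forall>x. \<exists>U. x \<in> interior U \<and> geodesically_convex U \<and> mcp K N (restrict_space m U))"

definition local_noncollapsed_mcp :: "'a::metric_space itself \<Rightarrow> real \<Rightarrow> real \<Rightarrow> bool" where
  "local_noncollapsed_mcp _ K n \<longleftrightarrow> local_mcp K n (hausdorff_measure n :: 'a measure)"

definition manifold_point :: "'a::metric_space \<Rightarrow> bool" where
  "manifold_point p \<longleftrightarrow>
     (\<exists>U k. p \<in> interior U \<and> top_of_set U homeomorphic_space Euclidean_space k)"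

section \<open>Completion of a pseudo-metric space\<close>

text \<open>
  The completion of the metric space associated with a pseudo-metric \<open>d\<close> on a set \<open>S\<close>, as
  the set of Cauchy sequences in \<open>S\<close> modulo sequences at asymptotic distance \<open>0\<close>.  This carries
  out the metric identification and the completion in a single quotient.
\<close>

definition cauchy_seqs :: "'b set \<Rightarrow> ('b \<Rightarrow> 'b \<Rightarrow> real) \<Rightarrow> (nat \<Rightarrow> 'b) set" where
  "cauchy_seqs S d = {u. range u \<subseteq> S \<and> (\<forall>e>0. \<exists>N. \<forall>i\<ge>N. \<forall>j\<ge>N. d (u i) (u j) < e)}"

definition asymptotic_rel :: "'b set \<Rightarrow> ('b \<Rightarrow> 'b \<Rightarrow> real) \<Rightarrow> ((nat \<Rightarrow> 'b) \<times> (nat \<Rightarrow> 'b)) set" where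
  "asymptotic_rel S d =
     {(u, v). u \<in> cauchy_seqs S d \<and> v \<in> cauchy_seqs S d \<and> (\<lambda>i. d (u i) (v i)) \<longlonglongrightarrow> 0}"

definition completion :: "'b set \<Rightarrow> ('b \<Rightarrow> 'b \<Rightarrow> real) \<Rightarrow> (nat \<Rightarrow> 'b) set set" where
  "completion S d = cauchy_seqs S d // asymptotic_rel S d"

definition completion_dist ::
    "('b \<Rightarrow> 'b \<Rightarrow> real) \<Rightarrow> (nat \<Rightarrow> 'b) set \<Rightarrow> (nat \<Rightarrow> 'b) set \<Rightarrow> real" where
  "completion_dist d V W = (THE r. \<forall>u\<in>V. \<forall>w\<in>W. (\<lambda>i. d (u i) (w i)) \<longlonglongrightarrow> r)"

definition completion_point :: "'b set \<Rightarrow> ('b \<Rightarrow> 'b \<Rightarrow> real) \<Rightarrow> 'b \<Rightarrow> (nat \<Rightarrow> 'b) set" where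
  "completion_point S d x = asymptotic_rel S d `` {\<lambda>_. x}"

lemma completion_dist_eq:
  fixes d :: "'b \<Rightarrow> 'b \<Rightarrow> real"
  assumes d: "\<And>x. x \<in> S \<Longrightarrow> d x x = 0" "\<And>x y. x \<in> S \<Longrightarrow> y \<in> S \<Longrightarrow> d x y = d y x"
    "\<And>x y z. x \<in> S \<Longrightarrow> y \<in> S \<Longrightarrow> z \<in> S \<Longrightarrow> d x z \<le> d x y + d y z"
    and u: "u \<in> cauchy_seqs S d" and v: "v \<in> cauchy_seqs S d"
  shows "(\<lambda>i. d (u i) (v i)) \<longlonglongrightarrow>
    completion_dist d (asymptotic_rel S d `` {u}) (asymptotic_rel S d `` {v})"
proof -
  have in_S: "w i \<in> S" if "w \<in> cauchy_seqs S d" for w i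
    using that by (auto simp: cauchy_seqs_def)
  have nn: "0 \<le> d x y" if "x \<in> S" "y \<in> S" for x y
    using d(1)[of x] d(2)[of x y] d(3)[of x y x] that by simp
  have quad: "\<bar>d x y - d x' y'\<bar> \<le> d x x' + d y y'" if "x \<in> S" "y \<in> S" "x' \<in> S" "y' \<in> S" for x y x' y'
    using d(3)[of x x' y] d(3)[of x' y' y] d(3)[of x' x y'] d(3)[of x y y'] d(2)[of x x'] d(2)[of y y'] that
    by simp
  have "Cauchy (\<lambda>i. d (u i) (v i))"
  proof (rule metric_CauchyI)
    fix e :: real assume "0 < e"
    then have e2: "0 < e/2" by simp
    have ex: "\<exists>N. \<forall>i\<ge>N. \<forall>j\<ge>N. d (w i) (w j) < e/2" if "w \<in> cauchy_seqs S d" for w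
      using that e2 unfolding cauchy_seqs_def mem_Collect_eq by (elim conjE allE[of _ "e/2"]) (erule mp)
    obtain M where M: "\<forall>i\<ge>M. \<forall>j\<ge>M. d (u i) (u j) < e/2" using ex[OF u] ..
    obtain N where N: "\<forall>i\<ge>N. \<forall>j\<ge>N. d (v i) (v j) < e/2" using ex[OF v] ..
    show "\<exists>M. \<forall>m\<ge>M. \<forall>n\<ge>M. dist (d (u m) (v m)) (d (u n) (v n)) < e"
    proof (intro exI[of _ "max M N"] allI impI)
      fix m n assume "max M N \<le> m" "max M N \<le> n"
      then have "d (u m) (u n) < e/2" "d (v m) (v n) < e/2" using M N by auto
      then show "dist (d (u m) (v m)) (d (u n) (v n)) < e"
        using quad[of "u m" "v m" "u n" "v n"] in_S u v by (simp add: dist_real_def)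
    qed
  qed
  then obtain r where r: "(\<lambda>i. d (u i) (v i)) \<longlonglongrightarrow> r"
    using real_Cauchy_convergent convergent_def by blast
  have all: "(\<lambda>i. d (u' i) (v' i)) \<longlonglongrightarrow> r"
    if "u' \<in> asymptotic_rel S d `` {u}" "v' \<in> asymptotic_rel S d `` {v}" for u' v'
  proof -
    have *: "u' \<in> cauchy_seqs S d" "v' \<in> cauchy_seqs S d"
      "(\<lambda>i. d (u i) (u' i)) \<longlonglongrightarrow> 0" "(\<lambda>i. d (v i) (v' i)) \<longlonglongrightarrow> 0"
      using that by (auto simp: asymptotic_rel_def)
    have "(\<lambda>i. d (u i) (u' i) + d (v i) (v' i)) \<longlonglongrightarrow> 0"
      using tendsto_add[OF *(3,4)] by simp
    then have "(\<lambda>i. d (u i) (v i) - d (u' i) (v' i)) \<longlonglongrightarrow> 0"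
      by (rule Lim_null_comparison[rotated]) (use quad in_S u v * in auto)
    from tendsto_diff[OF r this] show ?thesis by simp
  qed
  have refl: "w \<in> asymptotic_rel S d `` {w}" if "w \<in> cauchy_seqs S d" for w
    using that d(1) in_S by (auto simp: asymptotic_rel_def)
  have "completion_dist d (asymptotic_rel S d `` {u}) (asymptotic_rel S d `` {v}) = r"
    unfolding completion_dist_def
  proof (rule the_equality)
    fix r' assume "\<forall>u'\<in>asymptotic_rel S d `` {u}. \<forall>v'\<in>asymptotic_rel S d `` {v}. (\<lambda>i. d (u' i) (v' i)) \<longlonglongrightarrow> r'"
    then show "r' = r" using r refl u v LIMSEQ_unique by blast
  qed (use all in blast)
  with r show ?thesis by simp
qed

section \<open>The geodesic tangent cone and the exponential map\<close>

text \<open>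
  A unit speed shortest path is represented as a pair \<open>(l, \<gamma>)\<close> of its length and a map that is
  an isometric embedding on \<open>{0..l}\<close>.  Constant paths (\<open>l = 0\<close>) are excluded, since \<open>\<gamma> (a t)\<close>
  has to be defined for small \<open>t > 0\<close>.  Pairs differing only in the values of \<open>\<gamma>\<close> outside
  \<open>{0..l}\<close>, or in the length of the interval, are at pseudo-distance \<open>0\<close>.
\<close>

type_synonym 'a path_rep = "real \<times> (real \<Rightarrow> 'a)"

definition shortest_paths_from :: "'a::metric_space \<Rightarrow> 'a path_rep set" where
  "shortest_paths_from p = {(l, \<gamma>). 0 < l \<and> shortest_path UNIV l \<gamma> \<and> \<gamma> 0 = p}"

definition cone_base :: "'a::metric_space \<Rightarrow> ('a path_rep \<times> real) set" where
  "cone_base p = shortest_paths_from p \<times> {0..}"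

definition cone_pdist :: "'a::metric_space path_rep \<times> real \<Rightarrow> 'a path_rep \<times> real \<Rightarrow> real" where
  "cone_pdist = (\<lambda>((_, \<gamma>), a) ((_, \<eta>), b). Lim (at_right 0) (\<lambda>t. dist (\<gamma> (a * t)) (\<eta> (b * t)) / t))"

type_synonym 'a cone_point = "(nat \<Rightarrow> 'a path_rep \<times> real) set"

definition tangent_cone :: "'a::metric_space \<Rightarrow> 'a cone_point set" where
  "tangent_cone p = completion (cone_base p) cone_pdist"

definition cone_dist :: "'a::metric_space cone_point \<Rightarrow> 'a cone_point \<Rightarrow> real" where
  "cone_dist = completion_dist cone_pdist"

definition cone_class :: "'a::metric_space \<Rightarrow> 'a path_rep \<Rightarrow> real \<Rightarrow> 'a cone_point" where
  "cone_class p g a = completion_point (cone_base p) cone_pdist (g, a)"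

definition cone_apex :: "'a::metric_space \<Rightarrow> 'a cone_point" where
  "cone_apex p = (THE v. \<exists>g\<in>shortest_paths_from p. v = cone_class p g 0)"

definition cone_ball :: "'a::metric_space \<Rightarrow> real \<Rightarrow> 'a cone_point set" where
  "cone_ball p r = {v \<in> tangent_cone p. cone_dist (cone_apex p) v < r}"

text \<open>
  \<open>exp_rel p v x\<close>: the cone point \<open>v\<close> is represented by a pair \<open>(\<gamma>, t)\<close> with \<open>\<gamma>\<close> defined on
  \<open>{0..t}\<close>, and \<open>x = \<gamma> t\<close>.
\<close>

definition exp_rel :: "'a::metric_space \<Rightarrow> 'a cone_point \<Rightarrow> 'a \<Rightarrow> bool" where
  "exp_rel p v x \<longleftrightarrow>
     (\<exists>l \<gamma> t. (l, \<gamma>) \<in> shortest_paths_from p \<and> 0 \<le> t \<and> t \<le> l \<and> v = cone_class p (l, \<gamma>) t \<and> x = \<gamma> t)"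

definition exp_map :: "'a::metric_space \<Rightarrow> 'a cone_point \<Rightarrow> 'a" where
  "exp_map p v = (THE x. exp_rel p v x)"

definition exp_well_defined :: "'a::metric_space \<Rightarrow> real \<Rightarrow> bool" where
  "exp_well_defined p r \<longleftrightarrow> (\<forall>v\<in>cone_ball p r. \<exists>!x. exp_rel p v x)"

definition almost_isometry ::
    "real \<Rightarrow> 'b set \<Rightarrow> ('b \<Rightarrow> 'b \<Rightarrow> real) \<Rightarrow> 'c set \<Rightarrow> ('c \<Rightarrow> 'c \<Rightarrow> real) \<Rightarrow> ('b \<Rightarrow> 'c) \<Rightarrow> bool" where
  "almost_isometry \<epsilon> Y dY Z dZ f \<longleftrightarrow>
     f ` Y = Z \<and> (\<forall>y\<in>Y. \<forall>y'\<in>Y. y \<noteq> y' \<longrightarrow> \<bar>dZ (f y) (f y') / dY y y' - 1\<bar> \<le> \<epsilon>)"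

end

theory Submission
  imports Defs "HOL-Homology.Brouwer_Degree" "HOL-Real_Asymp.Real_Asymp"
begin

text \<open>
  By the Busemann condition the contraction \<open>x \<mapsto> x\<^sub>t\<close> towards \<open>p\<close> is \<open>t\<close>-Lipschitz, so it
  multiplies the \<open>n\<close>-dimensional Hausdorff measure by at most \<open>t\<^sup>n\<close>; by the measure contraction
  property it multiplies it by almost \<open>t\<^sup>n\<close> at least.  At a manifold point shortest paths extend to
  a uniform length, because otherwise a geodesic contraction would contract small spheres in a chart;
  hence contractions between concentric balls are surjective and all small balls near \<open>p\<close> have almost
  the volume \<open>\<theta> r\<^sup>n\<close> with a common \<open>\<theta>\<close>.  A \<open>t\<close>-Lipschitz map that almost preserves volume in this
  sense cannot shorten any distance by much more than the factor \<open>t\<close>, uniformly in \<open>t\<close>, and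
  letting \<open>t\<close> tend to \<open>0\<close> compares the distance of the tangent cone with that of the space.
\<close>

section \<open>Contractions of Euclidean charts\<close>

text \<open>Only one half of the comparison is hard: contracting by \<open>t\<close> and dividing by
  \<open>t\<close> shows at once that, near the apex, the cone distance is at most the distance in
  the space. The reverse bound must be uniform in \<open>t\<close>, or it would not survive the
  limit. Volume supplies this uniformity, because the balls in the argument and their contracted
  images differ by the same factor \<open>t powr n\<close>, which cancels.

  A second obstacle is that the cone is a completion. A point of its ball is a class of Cauchy
  sequences of paths, whose lengths may shrink to 0, so it is not clear that it comes from a path at
  all. The lower bound turns such a sequence into a Cauchy sequence of end points in the space, and
  the path to their limit represents the class; extension to a uniform length makes these end points
  available.

  Geodesics are handled through equations between distances (\<open>lies_between\<close>,
  \<open>intermediate\<close>) instead of parametrizations, so that uniqueness of intermediate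
  points is used only near \<open>p\<close>.\<close>

lemma nsphere_eq_top_of_set:
  "nsphere n = top_of_set {u. (\<Sum>i\<le>n. u i ^ 2) = 1 \<and> (\<forall>i>n. u i = 0)}"
  by (simp add: nsphere euclidean_product_topology)

lemma Euclidean_space_eq_top_of_set: "Euclidean_space n = top_of_set {f. \<forall>i\<ge>n. f i = 0}"
  by (simp add: Euclidean_space_def euclidean_product_topology)

text \<open>Only the coordinates up to \<open>n\<close> move, so the minimum of finitely many radii
  serves all of them. The bound is closed so that a sphere of exactly that radius fits.\<close>

lemma box_in_open_product:
  fixes T :: "(nat \<Rightarrow> real) set"
  assumes "open T" "c \<in> T"
  shows "\<exists>r>0. \<forall>u. (\<forall>i\<le>n. \<bar>u i\<bar> \<le> r) \<longrightarrow> (\<forall>i>n. u i = 0) \<longrightarrow> (\<lambda>i. c i + u i) \<in> T"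
proof -
  have "openin (product_topology (\<lambda>i. euclidean) UNIV) T"
    using assms(1) by (simp add: euclidean_product_topology)
  from product_topology_open_contains_basis[OF this assms(2)]
  obtain X where X: "c \<in> (\<Pi>\<^sub>E i\<in>UNIV. X i)" "\<And>i. open (X i)" "(\<Pi>\<^sub>E i\<in>UNIV. X i) \<subseteq> T"
    by auto
  have "\<exists>e>0. cball (c i) e \<subseteq> X i" for i
    using X(1,2) by (auto simp: open_contains_cball)
  then obtain e where e: "\<And>i. 0 < e i" "\<And>i. cball (c i) (e i) \<subseteq> X i" by metis
  show ?thesis
  proof (intro exI conjI allI impI)
    show "0 < Min (e ` {..n})" using e by simp
    fix u :: "nat \<Rightarrow> real"
    assume u: "\<forall>i\<le>n. \<bar>u i\<bar> \<le> Min (e ` {..n})" "\<forall>i>n. u i = 0"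
    have "c i + u i \<in> X i" for i
    proof (cases "i \<le> n")
      case True
      then have "\<bar>u i\<bar> \<le> e i" using u(1) True by simp 
      then show ?thesis using e(2)[of i] by (auto simp: dist_real_def subset_iff)
    next
      case False then show ?thesis using u(2) X(1) by auto
    qed
    then show "(\<lambda>i. c i + u i) \<in> T" using X(3) by auto
  qed
qed

text \<open>
  A contraction avoiding \<open>x\<close>, followed by the radial projection of a chart away from \<open>x\<close>, would
  contract a small coordinate sphere around \<open>x\<close> within itself.
\<close>

lemma contraction_hits_interior_point:
  fixes x q :: "'a::metric_space" and h :: "real \<times> 'a \<Rightarrow> 'a"
  assumes U: "top_of_set U homeomorphic_space Euclidean_space k"
    and W: "open W" "x \<in> W" "W \<subseteq> U"
    and h: "continuous_on ({0..1} \<times> W) h" "h ` ({0..1} \<times> W) \<subseteq> U"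
      "\<And>y. y \<in> W \<Longrightarrow> h (1, y) = y" "\<And>y. y \<in> W \<Longrightarrow> h (0, y) = q"
    and "q \<noteq> x"
  shows "\<exists>y\<in>W. y \<noteq> x \<and> (\<exists>t\<in>{0..1}. h (t, y) = x)"
proof (rule ccontr)
  assume "\<not> ?thesis"
  then have avoid: "h (t, y) \<noteq> x" if "y \<in> W" "y \<noteq> x" "t \<in> {0..1}" for t y using that by blast
  let ?E = "\<lambda>k. {f::nat\<Rightarrow>real. \<forall>i\<ge>k. f i = 0}"
  obtain \<phi> \<psi> where "homeomorphic_maps (top_of_set U) (top_of_set (?E k)) \<phi> \<psi>"
    using U unfolding homeomorphic_space_def Euclidean_space_eq_top_of_set by blast
  then have \<phi>: "continuous_on U \<phi>" "\<And>y. y \<in> U \<Longrightarrow> \<phi> y \<in> ?E k" "\<And>y. y \<in> U \<Longrightarrow> \<psi> (\<phi> y) = y"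
    and \<psi>: "continuous_on (?E k) \<psi>" "\<And>z. z \<in> ?E k \<Longrightarrow> \<psi> z \<in> U" "\<And>z. z \<in> ?E k \<Longrightarrow> \<phi> (\<psi> z) = z"
    by (auto simp: homeomorphic_maps_def)
  have xU: "x \<in> U" using W by auto
  have qU: "q \<in> U" using h(4)[OF W(2)] h(2) W(2) by force
  have inj: "\<phi> y \<noteq> \<phi> z" if "y \<in> U" "z \<in> U" "y \<noteq> z" for y z using \<phi>(3) that by metis
  \<comment> \<open>A zero-dimensional chart is a single point, yet it contains both
    \<open>q\<close> and \<open>x\<close>.\<close>
  have "k \<noteq> 0"
  proof
    assume "k = 0"
    then have "\<phi> q = (\<lambda>_. 0)" "\<phi> x = (\<lambda>_. 0)" using \<phi>(2)[OF qU] \<phi>(2)[OF xU] by auto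
    then show False using inj[OF qU xU \<open>q \<noteq> x\<close>] by simp
  qed
  \<comment> \<open>The unit sphere of \<open>Euclidean_space (Suc n)\<close> is
    \<open>nsphere n\<close>, whence the shift.\<close>
  then obtain n where k: "k = Suc n" using not0_implies_Suc by blast
  define c where "c = \<phi> x"
  have cE: "c \<in> ?E k" using \<phi>(2)[OF xU] by (simp add: c_def)
  have "openin (top_of_set (?E k)) (?E k \<inter> \<psi> -` W)"
    using \<psi>(1) W(1) by (rule continuous_openin_preimage_gen)
  then obtain T where T: "open T" "?E k \<inter> \<psi> -` W = ?E k \<inter> T" by (auto simp: openin_open)
  have "\<psi> c = x" unfolding c_def using xU by (rule \<phi>(3))
  then have "c \<in> T" using T(2) cE W(2) by blast
  then obtain r where r: "0 < r" "\<And>u. \<forall>i\<le>n. \<bar>u i\<bar> \<le> r \<Longrightarrow> \<forall>i>n. u i = 0 \<Longrightarrow> (\<lambda>i. c i + u i) \<in> T"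
    using box_in_open_product[OF T(1)] by blast
  define S where "S = {u::nat\<Rightarrow>real. (\<Sum>i\<le>n. u i ^ 2) = 1 \<and> (\<forall>i>n. u i = 0)}"
  define N where "N z = sqrt (\<Sum>i\<le>n. (z i - c i)\<^sup>2)" for z
  define rad where "rad z i = (z i - c i) / N z" for z i
  define j where "j u i = c i + r * u i" for u i
  have S_le: "\<bar>u i\<bar> \<le> 1" if "u \<in> S" "i \<le> n" for u i
  proof -
    have "(u i)\<^sup>2 \<le> (\<Sum>i\<le>n. u i ^ 2)" using that(2) by (intro member_le_sum) auto
    then show ?thesis using that(1) by (simp add: S_def abs_square_le_1)
  qed
  have jE: "j u \<in> ?E k" if "u \<in> S" for u using that cE by (auto simp: S_def j_def k)
  have jT: "j u \<in> T" if "u \<in> S" for u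
    unfolding j_def using S_le[OF that] that r(1)
    by (intro r(2)) (auto simp: abs_mult S_def mult_left_le)
  have jW: "\<psi> (j u) \<in> W" if "u \<in> S" for u using jE[OF that] jT[OF that] T(2) by blast
  have Nj: "N (j u) = r" if "u \<in> S" for u
    using that r(1) by (simp add: N_def j_def S_def power_mult_distrib sum_distrib_left[symmetric])
  have j_ne: "\<psi> (j u) \<noteq> x" if "u \<in> S" for u
  proof
    assume "\<psi> (j u) = x"
    then have "j u = c" using \<psi>(3)[OF jE[OF that]] by (simp add: c_def)
    then have "N (j u) = 0" by (simp add: N_def)
    then show False using Nj[OF that] r(1) by simp
  qed
  have N_pos: "0 < N z" if "z \<in> ?E k" "z \<noteq> c" for z
  proof -
    obtain i where i: "z i \<noteq> c i" using \<open>z \<noteq> c\<close> by auto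
    \<comment> \<open>The coordinates from \<open>k\<close> on vanish for both points, so they can
      differ only at an index up to \<open>n\<close>.\<close>
    then have "i \<le> n" using that(1) cE k by (metis (mono_tags, lifting) mem_Collect_eq not_less_eq_eq)
    have "0 < (z i - c i)\<^sup>2" using i by simp
    also have "\<dots> \<le> (\<Sum>i\<le>n. (z i - c i)\<^sup>2)" using \<open>i \<le> n\<close> by (intro member_le_sum) auto
    finally show ?thesis by (simp add: N_def)
  qed
  have rad_S: "rad z \<in> S" if "z \<in> ?E k" "z \<noteq> c" for z
  proof -
    have "(\<Sum>i\<le>n. (rad z i)\<^sup>2) = (\<Sum>i\<le>n. (z i - c i)\<^sup>2) / (N z)\<^sup>2"
      by (simp add: rad_def power_divide sum_divide_distrib)
    also have "(N z)\<^sup>2 = (\<Sum>i\<le>n. (z i - c i)\<^sup>2)" unfolding N_def by (simp add: sum_nonneg)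
    finally have "(\<Sum>i\<le>n. (rad z i)\<^sup>2) = 1" using N_pos[OF that] by (simp add: N_def)
    then show ?thesis using that(1) cE by (auto simp: S_def rad_def k)
  qed
  \<comment> \<open>\<open>H\<close> is the motion of the coordinate sphere under the contraction,
    read in the chart. It avoids \<open>c\<close> because the contraction avoids \<open>x\<close>,
    so \<open>rad\<close> can be applied to it.\<close>
  define H where "H p = (case p of (t, u) \<Rightarrow> \<phi> (h (t, \<psi> (j u))))" for p
  have hU: "h (t, \<psi> (j u)) \<in> U" "h (t, \<psi> (j u)) \<noteq> x" if "t \<in> {0..1}" "u \<in> S" for t u
    using that h(2) jW[OF that(2)] avoid j_ne[OF that(2)] by auto
  have HE: "H (t, u) \<in> ?E k" "H (t, u) \<noteq> c" if "t \<in> {0..1}" "u \<in> S" for t u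
  proof -
    show "H (t, u) \<in> ?E k" using \<phi>(2)[OF hU(1)[OF that]] by (simp add: H_def)
    show "H (t, u) \<noteq> c" using inj[OF hU(1)[OF that] xU hU(2)[OF that]] by (simp add: H_def c_def)
  qed
  have cj: "continuous_on A j" for A
    unfolding j_def
    by (intro continuous_intros continuous_on_product_then_coordinatewise[OF continuous_on_id, unfolded id_def])
  have "continuous_on ({0..1} \<times> S) (\<lambda>p. \<psi> (j (snd p)))"
    by (rule continuous_on_compose2[OF \<psi>(1) continuous_on_compose2[OF cj continuous_on_snd]])
      (use jE in \<open>auto intro: continuous_on_id\<close>)
  then have "continuous_on ({0..1} \<times> S) (\<lambda>p. h (fst p, \<psi> (j (snd p))))"
    using jW by (intro continuous_on_compose2[OF h(1)] continuous_intros) auto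
  then have "continuous_on ({0..1} \<times> S) (\<lambda>p. \<phi> (h (fst p, \<psi> (j (snd p)))))"
    using hU by (intro continuous_on_compose2[OF \<phi>(1)]) auto
  then have cH: "continuous_on ({0..1} \<times> S) H"
    by (simp add: H_def case_prod_unfold)
  have cHi: "continuous_on ({0..1} \<times> S) (\<lambda>p. H p i)" for i
    using cH by (rule continuous_on_product_then_coordinatewise)
  have "continuous_on ({0..1} \<times> S) (\<lambda>p. N (H p))"
    unfolding N_def by (intro continuous_intros cHi)
  then have cR: "continuous_on ({0..1} \<times> S) (\<lambda>p. rad (H p))"
    unfolding rad_def using N_pos[OF HE]
    by (intro continuous_on_coordinatewise_then_product continuous_on_divide continuous_on_diff
        cHi continuous_on_const) force+
  have rad_j: "rad (j u) = u" if "u \<in> S" for u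
  proof
    fix i show "rad (j u) i = u i"
      unfolding rad_def Nj[OF that] using r(1) by (simp add: j_def)
  qed
  have start: "rad (H (1, u)) = u" if "u \<in> S" for u
    using h(3)[OF jW[OF that]] \<psi>(3)[OF jE[OF that]] rad_j[OF that] by (simp add: H_def)
  \<comment> \<open>At time 0 the projected motion is constant, at time 1 it is the identity of the
    sphere.\<close>
  have "homotopic_with_canon (\<lambda>_. True) S S (\<lambda>_. rad (\<phi> q)) id"
  proof (subst homotopic_with, simp, intro exI conjI allI ballI)
    show "continuous_map (prod_topology (top_of_set {0..1}) (top_of_set S)) (top_of_set S) (\<lambda>p. rad (H p))"
      using cR rad_S[OF HE] by (auto simp: image_subset_iff)
  qed (use start h(4) jW in \<open>auto simp: H_def\<close>)
  then have "contractible S" 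
    by (auto simp: contractible_def homotopic_with_sym)
  then have "contractible_space (nsphere n)" by (simp add: nsphere_eq_top_of_set S_def)
  then show False by (simp add: non_contractible_space_nsphere)
qed

section \<open>Geodesic contractions\<close>

text \<open>In a geodesic space this says that \<open>x\<close> lies on some shortest path from
  \<open>q\<close> to \<open>y\<close>. The distance form passes to limits without any choice of
  paths.\<close>

definition lies_between :: "'a::metric_space \<Rightarrow> 'a \<Rightarrow> 'a \<Rightarrow> bool" where
  "lies_between q x y \<longleftrightarrow> dist q y = dist q x + dist x y"

text \<open>The second equation places \<open>z\<close> on a shortest path, not merely on a sphere
  about \<open>q\<close>.\<close>

definition intermediate :: "'a::metric_space \<Rightarrow> real \<Rightarrow> 'a \<Rightarrow> 'a \<Rightarrow> bool" where
  "intermediate q t x z \<longleftrightarrow> dist q z = t * dist q x \<and> dist z x = (1 - t) * dist q x"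

lemma lies_between_trans: "lies_between q x y \<Longrightarrow> lies_between q y z \<Longrightarrow> lies_between q x z"
  using dist_triangle[of q z x] dist_triangle[of x z y] unfolding lies_between_def by linarith

lemma lies_between_refl [simp]: "lies_between q x x"
  by (simp add: lies_between_def)

text \<open>Serves to cut an extension beyond \<open>x\<close> at a prescribed length.\<close>

lemma lies_between_intermediate:
  assumes "lies_between q x y" "intermediate x s y z"
  shows "lies_between q x z"
proof -
  have "dist x z = s * dist x y" "dist z y = dist x y - s * dist x y"
    using assms(2) by (simp_all add: intermediate_def left_diff_distrib)
  then show ?thesis
    using assms(1) dist_triangle[of q y z] dist_triangle[of q z x] unfolding lies_between_def by linarith
qed

lemma intermediate_between: "intermediate q t x z \<Longrightarrow> lies_between q z x"
  by (simp add: intermediate_def lies_between_def algebra_simps)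

lemma lies_between_imp_intermediate:
  assumes "lies_between q z x" "q \<noteq> x"
  shows "intermediate q (dist q z / dist q x) x z"
  using assms zero_less_dist_iff[of q x] by (simp add: intermediate_def lies_between_def left_diff_distrib)

lemma intermediate_dist_le: "intermediate q t x z \<Longrightarrow> dist q z \<le> dist q x"
  by (drule intermediate_between) (simp add: lies_between_def)

lemma intermediate_0: "intermediate q 0 x z \<longleftrightarrow> z = q"
  by (auto simp: intermediate_def)

lemma intermediate_1: "intermediate q 1 x z \<longleftrightarrow> z = x"
  by (auto simp: intermediate_def)

text \<open>The route through \<open>z\<close> bounds \<open>dist w y\<close> above, and the
  triangle inequality from \<open>q\<close> to \<open>y\<close> through \<open>w\<close> bounds it
  below.\<close>

lemma intermediate_trans:
  assumes "intermediate q t y z" "intermediate q s z w"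
  shows "intermediate q (s * t) y w"
proof -
  have 1: "dist q z = t * dist q y" "dist z y = dist q y - t * dist q y"
    "dist q w = s * (t * dist q y)" "dist w z = t * dist q y - s * (t * dist q y)"
    using assms by (simp_all add: intermediate_def left_diff_distrib)
  have "dist w y = dist q y - s * (t * dist q y)"
    using 1 dist_triangle[of w y z] dist_triangle[of q y w] by linarith
  with 1 show ?thesis by (simp add: intermediate_def algebra_simps)
qed

text \<open>
  For fixed \<open>q\<close>, the relation \<open>lies_between q\<close> is a closed order along which the distance to \<open>q\<close>
  measures the distance between points, so a greedy increasing sequence converges to a maximal point.
\<close>

lemma maximal_extension:
  fixes q x :: "'a::metric_space"
  assumes "complete (UNIV :: 'a set)" "dist q x \<le> L"
  shows "\<exists>z. lies_between q x z \<and> dist q z \<le> L \<and> (\<forall>w. lies_between q z w \<and> dist q w \<le> L \<longrightarrow> w = z)"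
proof -
  let ?P = "\<lambda>z. lies_between q x z \<and> dist q z \<le> L"
  have step: "\<exists>z'. ?P z' \<and> lies_between q z z' \<and>
      (\<forall>w. lies_between q z w \<and> dist q w \<le> L \<longrightarrow> dist q w \<le> dist q z' + 1 / real (Suc i))" if z: "?P z" for z i
  proof -
    \<comment> \<open>The next point is chosen within \<open>1 / real (Suc i)\<close> of the largest
      distance from \<open>q\<close> reachable beyond \<open>z\<close>.\<close>
    let ?S = "dist q ` {w. lies_between q z w \<and> dist q w \<le> L}"
    have bdd: "bdd_above ?S" by (auto intro!: bdd_aboveI[of _ L])
    have "dist q z \<in> ?S" using z by auto
    then have "\<exists>v\<in>?S. Sup ?S - 1 / real (Suc i) < v"
      using less_cSup_iff[of ?S "Sup ?S - 1 / real (Suc i)"] bdd by auto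
    then obtain z' where z': "lies_between q z z'" "dist q z' \<le> L" "Sup ?S - 1 / real (Suc i) < dist q z'" by auto
    have "dist q w \<le> dist q z' + 1 / real (Suc i)" if "lies_between q z w" "dist q w \<le> L" for w
      using cSup_upper[of "dist q w" ?S] that bdd z'(3) by auto
    then show ?thesis using z z' lies_between_trans by blast
  qed
  have "\<exists>u. \<forall>i. ?P (u i) \<and> (lies_between q (u i) (u (Suc i)) \<and>
      (\<forall>w. lies_between q (u i) w \<and> dist q w \<le> L \<longrightarrow> dist q w \<le> dist q (u (Suc i)) + 1 / real (Suc i)))"
  proof (rule dependent_nat_choice)
    show "\<exists>z. ?P z" using assms(2) by (intro exI[of _ x]) simp
  qed (use step in blast)
  then obtain u where u: "\<And>i. lies_between q x (u i)" "\<And>i. dist q (u i) \<le> L" "\<And>i. lies_between q (u i) (u (Suc i))"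
    "\<And>i w. lies_between q (u i) w \<Longrightarrow> dist q w \<le> L \<Longrightarrow> dist q w \<le> dist q (u (Suc i)) + 1 / real (Suc i)"
    by blast
  have mono: "lies_between q (u i) (u j)" if "i \<le> j" for i j
    using that by (induction j rule: dec_induct) (auto intro: lies_between_trans u(3))
  have dist_u: "dist (u i) (u j) = dist q (u j) - dist q (u i)" if "i \<le> j" for i j
    using mono[OF that] by (simp add: lies_between_def)
  have "incseq (\<lambda>i. dist q (u i))"
    unfolding incseq_def using dist_u by (metis diff_ge_0_iff_ge zero_le_dist)
  moreover have "bdd_above (range (\<lambda>i. dist q (u i)))" using u(2) by (auto intro!: bdd_aboveI[of _ L])
  ultimately have cauchy: "Cauchy (\<lambda>i. dist q (u i))"
    using LIMSEQ_incseq_SUP LIMSEQ_imp_Cauchy by blast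
  have "Cauchy u"
  proof (rule metric_CauchyI)
    fix e :: real assume "0 < e"
    with cauchy obtain M where M: "\<And>m n. m \<ge> M \<Longrightarrow> n \<ge> M \<Longrightarrow> dist (dist q (u m)) (dist q (u n)) < e"
      unfolding Cauchy_def by blast
    have "dist (u m) (u n) < e" if "m \<ge> M" "n \<ge> M" for m n
    proof (cases "m \<le> n")
      case True then show ?thesis using M[OF that] dist_u[of m n] by (simp add: dist_real_def)
    next
      case False
      then show ?thesis using M[OF that] dist_u[of n m] by (simp add: dist_real_def dist_commute)
    qed
    then show "\<exists>M. \<forall>m\<ge>M. \<forall>n\<ge>M. dist (u m) (u n) < e" by blast
  qed
  then obtain v where v: "u \<longlonglongrightarrow> v"
    using assms(1) unfolding complete_def by auto
  have uv: "lies_between q (u i) v" for i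
  proof -
    have "(\<lambda>j. dist q (u j)) \<longlonglongrightarrow> dist q v" by (intro tendsto_intros v)
    moreover have "\<forall>\<^sub>F j in sequentially. dist q (u j) = dist q (u i) + dist (u i) (u j)"
      using eventually_ge_at_top[of i] by eventually_elim (simp add: dist_u)
    ultimately have "(\<lambda>j. dist q (u i) + dist (u i) (u j)) \<longlonglongrightarrow> dist q v"
      by (rule Lim_transform_eventually)
    moreover have "(\<lambda>j. dist q (u i) + dist (u i) (u j)) \<longlonglongrightarrow> dist q (u i) + dist (u i) v"
      by (intro tendsto_intros v)
    ultimately show ?thesis unfolding lies_between_def by (rule LIMSEQ_unique)
  qed
  have vL: "dist q v \<le> L"
    by (rule LIMSEQ_le_const2[of "\<lambda>j. dist q (u j)"]) (auto intro: tendsto_intros v u(2))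
  show ?thesis
  proof (intro exI conjI allI impI)
    show "lies_between q x v" using u(1) uv lies_between_trans by blast
    fix w assume w: "lies_between q v w \<and> dist q w \<le> L"
    \<comment> \<open>A point beyond \<open>v\<close> lies beyond every \<open>u i\<close>, so each
      greedy choice limits how much farther it can be.\<close>
    have "dist q w - dist q v \<le> 1 / real (Suc i)" for i
    proof -
      have "dist q w \<le> dist q (u (Suc i)) + 1 / real (Suc i)"
        using u(4) w lies_between_trans uv by blast
      moreover have "dist q (u (Suc i)) \<le> dist q v"
        using uv[of "Suc i"] zero_le_dist[of "u (Suc i)" v] unfolding lies_between_def by linarith
      ultimately show ?thesis by linarith
    qed
    then have "dist q w - dist q v \<le> 0"
      using LIMSEQ_le_const[OF LIMSEQ_inverse_real_of_nat] by (metis inverse_eq_divide)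
    then show "w = v" using w by (simp add: lies_between_def)
  qed (rule vL)
qed

section \<open>Shortest paths and metric intermediate points\<close>

lemma shortest_path_intermediate:
  assumes "shortest_path S l \<gamma>" "0 \<le> a" "a \<le> l" "0 \<le> s" "s \<le> 1"
  shows "intermediate (\<gamma> 0) s (\<gamma> a) (\<gamma> (s * a))"
proof -
  have "0 \<le> s * a" "s * a \<le> a" using assms by (auto simp: mult_left_le_one_le)
  then show ?thesis
    using assms by (auto simp: intermediate_def shortest_path_def left_diff_distrib)
qed

lemma shortest_path_dist:
  assumes "shortest_path S l \<gamma>" "0 \<le> a" "a \<le> l"
  shows "dist (\<gamma> 0) (\<gamma> a) = a"
  using assms by (auto simp: shortest_path_def)

text \<open>Shortest paths from \<open>q\<close> to \<open>z\<close> and from \<open>z\<close> to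
  \<open>x\<close> concatenate to a shortest path, because the distances add up.\<close>

lemma intermediate_shortest_path:
  fixes q x z :: "'a::metric_space"
  assumes geo: "geodesic_space (UNIV :: 'a set)" and t: "0 \<le> t" "t \<le> 1" and z: "intermediate q t x z"
  shows "\<exists>\<gamma>. shortest_path_from_to UNIV q x \<gamma> \<and> \<gamma> (t * dist q x) = z"
proof -
  obtain \<alpha> \<beta> where \<alpha>: "shortest_path_from_to UNIV q z \<alpha>" and \<beta>: "shortest_path_from_to UNIV z x \<beta>"
    using geo unfolding geodesic_space_def by blast
  define a b where "a = dist q z" and "b = dist z x"
  have ab: "dist q x = a + b"
    using intermediate_between[OF z] by (simp add: a_def b_def lies_between_def)
  have pos: "0 \<le> a" "0 \<le> b" by (simp_all add: a_def b_def)
  have ta: "t * dist q x = a" using z by (simp add: a_def intermediate_def)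
  have \<alpha>': "dist (\<alpha> s) (\<alpha> s') = \<bar>s - s'\<bar>" if "s \<in> {0..a}" "s' \<in> {0..a}" for s s'
    using that \<alpha> by (auto simp: shortest_path_from_to_def shortest_path_def a_def)
  have \<beta>': "dist (\<beta> s) (\<beta> s') = \<bar>s - s'\<bar>" if "s \<in> {0..b}" "s' \<in> {0..b}" for s s'
    using that \<beta> by (auto simp: shortest_path_from_to_def shortest_path_def b_def)
  have ends: "\<alpha> 0 = q" "\<alpha> a = z" "\<beta> 0 = z" "\<beta> b = x"
    using \<alpha> \<beta> by (auto simp: shortest_path_from_to_def a_def b_def)
  define \<gamma> where "\<gamma> s = (if s \<le> a then \<alpha> s else \<beta> (s - a))" for s
  \<comment> \<open>For points on different pieces the detour through \<open>z\<close> bounds the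
    distance above, and \<open>dist q x = a + b\<close> bounds it below.\<close>
  have mixed: "dist (\<alpha> s) (\<beta> (s' - a)) = s' - s" if "0 \<le> s" "s \<le> a" "a < s'" "s' \<le> a + b" for s s'
  proof -
    have "dist (\<alpha> s) z = a - s" "dist z (\<beta> (s' - a)) = s' - a" "dist q (\<alpha> s) = s"
      "dist (\<beta> (s' - a)) x = a + b - s'"
      using \<alpha>'[of s a] \<beta>'[of 0 "s' - a"] \<alpha>'[of 0 s] \<beta>'[of "s' - a" b] that ends by auto
    then show ?thesis
      using dist_triangle[of "\<alpha> s" "\<beta> (s' - a)" z] dist_triangle[of q x "\<alpha> s"]
        dist_triangle[of "\<alpha> s" x "\<beta> (s' - a)"] ab by linarith
  qed
  have iso: "dist (\<gamma> s) (\<gamma> s') = \<bar>s - s'\<bar>" if "s \<in> {0..a+b}" "s' \<in> {0..a+b}" for s s'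
    using that mixed[of s s'] mixed[of s' s] \<alpha>'[of s s'] \<beta>'[of "s - a" "s' - a"]
    by (auto simp: \<gamma>_def dist_commute)
  have "\<gamma> 0 = q" "\<gamma> (a + b) = x" "\<gamma> a = z" using ends pos by (auto simp: \<gamma>_def)
  then have "shortest_path_from_to UNIV q x \<gamma> \<and> \<gamma> (t * dist q x) = z"
    unfolding shortest_path_from_to_def shortest_path_def ta unfolding ab using iso pos by simp
  then show ?thesis by blast
qed

text \<open>The hypothesis \<open>ball\<close> keeps ambient shortest paths from \<open>q\<close> to
  \<open>x\<close> inside \<open>S\<close>, so uniqueness in \<open>S\<close> identifies the point
  described by \<open>intermediate_point\<close> with the metrically defined
  \<open>z\<close>.\<close>

lemma intermediate_point_eq:
  fixes q x z :: "'a::metric_space"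
  assumes geo: "geodesic_space (UNIV :: 'a set)" and S: "uniquely_geodesic_space S"
    and qx: "q \<in> S" "x \<in> S" and ball: "\<And>y. dist q y \<le> dist q x \<Longrightarrow> lies_between q y x \<Longrightarrow> y \<in> S"
    and t: "0 \<le> t" "t \<le> 1" and z: "intermediate q t x z"
  shows "intermediate_point S q t x = z"
proof -
  obtain \<gamma> where \<gamma>: "shortest_path_from_to UNIV q x \<gamma>" "\<gamma> (t * dist q x) = z"
    using intermediate_shortest_path[OF geo t z] by blast
  have \<gamma>': "dist (\<gamma> s) (\<gamma> s') = \<bar>s - s'\<bar>" if "s \<in> {0..dist q x}" "s' \<in> {0..dist q x}" for s s'
    using that \<gamma> by (auto simp: shortest_path_from_to_def shortest_path_def)
  have ends: "\<gamma> 0 = q" "\<gamma> (dist q x) = x" using \<gamma>(1) by (auto simp: shortest_path_from_to_def)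
  have "\<gamma> s \<in> S" if "s \<in> {0..dist q x}" for s
    using that \<gamma>'[of 0 s] \<gamma>'[of s "dist q x"] ends by (intro ball) (auto simp: lies_between_def)
  then have \<gamma>S: "shortest_path_from_to S q x \<gamma>"
    using \<gamma>(1) by (auto simp: shortest_path_from_to_def shortest_path_def)
  have tq: "t * dist q x \<in> {0..dist q x}" using t by (auto simp: mult_left_le_one_le)
  show ?thesis
    unfolding intermediate_point_def
  proof (rule the_equality)
    show "\<exists>\<gamma>. shortest_path_from_to S q x \<gamma> \<and> z \<in> \<gamma> ` {0..dist q x} \<and> dist q z = t * dist q x"
      using \<gamma>S \<gamma>(2) tq z by (auto simp: intermediate_def)
    fix y assume "\<exists>\<gamma>. shortest_path_from_to S q x \<gamma> \<and> y \<in> \<gamma> ` {0..dist q x} \<and> dist q y = t * dist q x"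
    then obtain \<eta> s where \<eta>: "shortest_path_from_to S q x \<eta>" "s \<in> {0..dist q x}" "y = \<eta> s" "dist q y = t * dist q x"
      by blast
    have "dist (\<eta> 0) (\<eta> s) = s"
      using \<eta>(1,2) by (intro shortest_path_dist[of S "dist q x"]) (auto simp: shortest_path_from_to_def)
    moreover have "\<eta> 0 = q" using \<eta>(1) by (auto simp: shortest_path_from_to_def)
    ultimately have "s = t * dist q x" using \<eta>(3,4) by simp
    moreover have "\<eta> (t * dist q x) = \<gamma> (t * dist q x)"
      using S qx \<gamma>S \<eta>(1) tq unfolding uniquely_geodesic_space_def by blast
    ultimately show "y = z" using \<eta>(3) \<gamma>(2) by simp
  qed
qed

text \<open>The Busemann inequality in relational form: the centre and the two points lie in the
  ball, while \<open>z\<close> and \<open>w\<close> are arbitrary intermediate points. Taking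
  \<open>x = y\<close> gives their uniqueness.\<close>

locale contracting_ball =
  fixes p :: "'a::metric_space" and \<rho> :: real
  assumes complete_UNIV: "complete (UNIV :: 'a set)"
    and radius_pos: "0 < \<rho>"
    and intermediate_exists: "\<And>q x :: 'a. \<And>t. 0 \<le> t \<Longrightarrow> t \<le> 1 \<Longrightarrow> \<exists>z. intermediate q t x z"
    and contraction: "\<And>q x y z w t. q \<in> ball p \<rho> \<Longrightarrow> x \<in> ball p \<rho> \<Longrightarrow> y \<in> ball p \<rho> \<Longrightarrow> 0 \<le> t \<Longrightarrow> t \<le> 1
        \<Longrightarrow> intermediate q t x z \<Longrightarrow> intermediate q t y w \<Longrightarrow> dist z w \<le> t * dist x y"

text \<open>The factor 3 arises because a point no farther from \<open>q\<close> than
  \<open>x\<close> is within \<open>2 * \<rho>\<close> of \<open>q\<close>, hence within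
  \<open>3 * \<rho>\<close> of \<open>p\<close>; so shortest paths between points of the small ball
  stay in \<open>W\<close>.\<close>

lemma busemann_contracting_ball:
  fixes p :: "'a::metric_space"
  assumes "complete (UNIV :: 'a set)" and geo: "geodesic_space (UNIV :: 'a set)"
    and W: "busemann_space W" "ball p (3 * \<rho>) \<subseteq> W" and "0 < \<rho>"
  shows "contracting_ball p \<rho>"
proof
  show "\<exists>z. intermediate q t x z" if "0 \<le> t" "t \<le> 1" for q x :: 'a and t
  proof -
    obtain \<gamma> where "shortest_path_from_to UNIV q x \<gamma>" using geo unfolding geodesic_space_def by blast
    then show ?thesis
      using shortest_path_intermediate[of UNIV "dist q x" \<gamma> "dist q x" t] that by (auto simp: shortest_path_from_to_def)
  qed
  fix q x y z w t
  assume *: "q \<in> ball p \<rho>" "x \<in> ball p \<rho>" "y \<in> ball p \<rho>" "0 \<le> t" "t \<le> 1" "intermediate q t x z" "intermediate q t y w"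
  have in_W: "v \<in> W" if "v \<in> ball p \<rho>" for v using that W(2) \<open>0 < \<rho>\<close> by auto
  have eq: "intermediate_point W q t x = z" if "x \<in> ball p \<rho>" "intermediate q t x z" for x z
  proof (rule intermediate_point_eq[OF geo])
    show "uniquely_geodesic_space W" using W(1) by (simp add: busemann_space_def)
    fix v assume "dist q v \<le> dist q x"
    then have "dist p v < 3 * \<rho>"
      using dist_triangle[of p v q] dist_triangle[of q x p] that(1) *(1) by (simp add: dist_commute)
    then show "v \<in> W" using W(2) by auto
  qed (use * that in_W in auto)
  have "dist (intermediate_point W q t x) (intermediate_point W q t y) \<le> t * dist x y"
    using W(1) * in_W unfolding busemann_space_def by auto
  then show "dist z w \<le> t * dist x y"
    using eq[OF *(2) *(6)] eq[OF *(3) *(7)] by simp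
qed (use assms in auto)

context contracting_ball
begin

text \<open>A choice of intermediate point; it is forced when \<open>q\<close> and \<open>x\<close>
  lie in the ball and \<open>t\<close> is between 0 and 1.\<close>

definition contract :: "'a \<Rightarrow> real \<Rightarrow> 'a \<Rightarrow> 'a" where
  "contract q t x = (SOME z. intermediate q t x z)"

lemma contract_intermediate: "0 \<le> t \<Longrightarrow> t \<le> 1 \<Longrightarrow> intermediate q t x (contract q t x)"
  unfolding contract_def by (rule someI_ex) (rule intermediate_exists)

lemma intermediate_unique:
  "q \<in> ball p \<rho> \<Longrightarrow> x \<in> ball p \<rho> \<Longrightarrow> 0 \<le> t \<Longrightarrow> t \<le> 1 \<Longrightarrow> intermediate q t x z \<Longrightarrow> intermediate q t x w \<Longrightarrow> z = w"
  using contraction[of q x x t z w] by simp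

lemma contract_eq:
  "q \<in> ball p \<rho> \<Longrightarrow> x \<in> ball p \<rho> \<Longrightarrow> 0 \<le> t \<Longrightarrow> t \<le> 1 \<Longrightarrow> intermediate q t x z \<Longrightarrow> contract q t x = z"
  using intermediate_unique[OF _ _ _ _ contract_intermediate] by blast

text \<open>For \<open>s \<le> t\<close>, uniqueness makes the point at \<open>s\<close> the
  intermediate point at \<open>s / t\<close> of the point at \<open>t\<close>.\<close>

lemma dist_contract_contract:
  assumes "q \<in> ball p \<rho>" "x \<in> ball p \<rho>" "0 \<le> s" "s \<le> 1" "0 \<le> t" "t \<le> 1"
  shows "dist (contract q s x) (contract q t x) = \<bar>s - t\<bar> * dist q x"
proof -
  have *: "dist (contract q s x) (contract q t x) = (t - s) * dist q x" if "0 \<le> s" "s \<le> t" "t \<le> 1" for s t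
  proof (cases "t = 0")
    case False
    then have st: "0 \<le> s / t" "s / t \<le> 1" "s / t * t = s" using that by auto
    have t: "intermediate q t x (contract q t x)" using that by (intro contract_intermediate) auto
    obtain w where w: "intermediate q (s / t) (contract q t x) w" using intermediate_exists st by blast
    from intermediate_trans[OF t w] have "intermediate q s x w" by (simp only: st)
    then have "contract q s x = w" using assms that by (intro contract_eq) auto
    moreover have "dist w (contract q t x) = (1 - s / t) * (t * dist q x)" using w t by (simp add: intermediate_def)
    moreover have "(1 - s / t) * t = t - s" using False by (simp add: field_simps)
    ultimately show ?thesis by (simp add: mult.assoc[symmetric])
  qed (use that in simp)
  show ?thesis
    using *[of s t] *[of t s] assms by (cases "s \<le> t") (auto simp: dist_commute)
qed

lemma continuous_on_contract:
  assumes "q \<in> ball p \<rho>"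
  shows "continuous_on ({0..1} \<times> ball p \<rho>) (\<lambda>(t, y). contract q t y)"
proof (rule continuous_onI)
  fix u :: "real \<times> 'a" and e :: real assume u: "u \<in> {0..1} \<times> ball p \<rho>" and "0 < e"
  obtain t y where ty: "u = (t, y)" by fastforce
  have t: "0 \<le> t" "t \<le> 1" "y \<in> ball p \<rho>" using u ty by auto
  \<comment> \<open>One half of \<open>e\<close> pays for moving \<open>y\<close>, the other for
    changing \<open>t\<close>; the \<open>+ 1\<close> covers \<open>y = q\<close>.\<close>
  define d where "d = min (e/2) (e / (2 * (dist q y + 1)))"
  have "0 < d" using \<open>0 < e\<close> by (simp add: d_def add_nonneg_pos)
  moreover have "dist (case v of (t, y) \<Rightarrow> contract q t y) (case u of (t, y) \<Rightarrow> contract q t y) \<le> e"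
    if v: "v \<in> {0..1} \<times> ball p \<rho>" "dist v u < d" for v
  proof -
    obtain s z where sz: "v = (s, z)" by fastforce
    have s: "0 \<le> s" "s \<le> 1" "z \<in> ball p \<rho>" using v sz by auto
    have "dist s t < d" "dist z y < d"
      using v(2) dist_fst_le[of v u] dist_snd_le[of v u] by (auto simp: sz ty)
    have "dist (contract q s z) (contract q s y) \<le> s * dist z y"
      using assms s t by (intro contraction[of q z y s] contract_intermediate) auto
    also have "\<dots> \<le> dist z y" using s by (simp add: mult_left_le_one_le)
    also have "\<dots> \<le> e / 2" using \<open>dist z y < d\<close> by (simp add: d_def)
    finally have 1: "dist (contract q s z) (contract q s y) \<le> e / 2" .
    have "dist (contract q s y) (contract q t y) = \<bar>s - t\<bar> * dist q y" using assms s t by (intro dist_contract_contract) auto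
    also have "\<dots> \<le> e / (2 * (dist q y + 1)) * (dist q y + 1)"
      using \<open>dist s t < d\<close> \<open>0 < e\<close> by (intro mult_mono) (auto simp: d_def dist_real_def)
    also have "\<dots> = e / 2"
      using zero_le_dist[of q y] by (simp add: field_simps add_nonneg_eq_0_iff)
    finally show ?thesis using 1 dist_triangle[of "contract q s z" "contract q t y" "contract q s y"] by (simp add: sz ty)
  qed
  ultimately show "\<exists>d>0. \<forall>v\<in>{0..1} \<times> ball p \<rho>. dist v u < d \<longrightarrow>
      dist (case v of (t, y) \<Rightarrow> contract q t y) (case u of (t, y) \<Rightarrow> contract q t y) \<le> e" by blast
qed

text \<open>The geodesic contraction to \<open>q\<close> is constant at time 0 and the identity at
  time 1, and the factor 3 keeps it inside the chart. Hence some other point \<open>y\<close> passes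
  through \<open>x\<close> on its way to \<open>q\<close>, which means that \<open>x\<close> lies
  between \<open>q\<close> and \<open>y\<close>.\<close>

lemma local_extension:
  assumes U: "top_of_set U homeomorphic_space Euclidean_space k" "ball p (3 * \<rho>) \<subseteq> U"
    and qx: "q \<in> ball p \<rho>" "x \<in> ball p \<rho>" "q \<noteq> x"
  shows "\<exists>y. y \<noteq> x \<and> lies_between q x y"
proof -
  have "\<exists>y\<in>ball p \<rho>. y \<noteq> x \<and> (\<exists>t\<in>{0..1}. (case (t, y) of (t, y) \<Rightarrow> contract q t y) = x)"
  proof (rule contraction_hits_interior_point[OF U(1)])
    show "ball p \<rho> \<subseteq> U" using U(2) radius_pos by auto
    show "(\<lambda>(t, y). contract q t y) ` ({0..1} \<times> ball p \<rho>) \<subseteq> U"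
    proof clarify
      fix t y assume "t \<in> {0..1::real}" "y \<in> ball p \<rho>"
      then have "dist q (contract q t y) \<le> dist q y" by (intro intermediate_dist_le[of _ t] contract_intermediate) auto
      then have "dist p (contract q t y) < 3 * \<rho>"
        using dist_triangle[of p "contract q t y" q] dist_triangle[of q y p] qx(1) \<open>y \<in> ball p \<rho>\<close>
        by (simp add: dist_commute)
      then show "contract q t y \<in> U" using U(2) by auto
    qed
    show "(case (1, y) of (t, y) \<Rightarrow> contract q t y) = y" for y using contract_intermediate[of 1 q y] by (simp add: intermediate_1)
    show "(case (0, y) of (t, y) \<Rightarrow> contract q t y) = q" for y using contract_intermediate[of 0 q y] by (simp add: intermediate_0)
  qed (use qx continuous_on_contract in auto)
  then obtain y t where "y \<noteq> x" "t \<in> {0..1}" "contract q t y = x" by auto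
  then have "lies_between q x y" using contract_intermediate[of t q y] intermediate_between by auto
  with \<open>y \<noteq> x\<close> show ?thesis by blast
qed

end

section \<open>Hausdorff measure and measure contraction\<close>

lemma diameter_le_dist:
  fixes S :: "'a::metric_space set"
  assumes "0 \<le> d" "\<And>x y. x \<in> S \<Longrightarrow> y \<in> S \<Longrightarrow> dist x y \<le> d"
  shows "diameter S \<le> d"
  using assms by (auto simp: diameter_def intro!: cSUP_least)

text \<open>Each set of a cover is cut down to \<open>A\<close> before it is mapped, since the
  Lipschitz bound holds on \<open>A\<close> only.\<close>

lemma hausdorff_content_lipschitz_image:
  fixes f :: "'a::metric_space \<Rightarrow> 'b::metric_space"
  assumes s: "0 < s" and L: "0 < L" and f: "\<And>x y. x \<in> A \<Longrightarrow> y \<in> A \<Longrightarrow> dist (f x) (f y) \<le> L * dist x y"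
    and "0 \<le> \<delta>"
  shows "hausdorff_content s (L * \<delta>) (f ` A) \<le> ennreal (L powr s) * hausdorff_content s \<delta> A"
proof -
  let ?c = "unit_ball_vol s / 2 powr s"
  have c: "0 \<le> ?c" using s by simp
  have inv: "ennreal (L powr s) * ennreal (1 / L powr s) = 1"
    using L by (simp add: ennreal_mult[symmetric])
  \<comment> \<open>With the factor moved to the left, the right-hand side is a bare infimum and
    each cover can be treated separately.\<close>
  have "ennreal (1 / L powr s) * hausdorff_content s (L * \<delta>) (f ` A) \<le> hausdorff_content s \<delta> A"
    unfolding hausdorff_content_def[of s \<delta> A]
  proof (rule INF_greatest, clarify)
    fix C :: "nat \<Rightarrow> 'a set" assume C: "A \<subseteq> (\<Union>i. C i)" "\<forall>i. bounded (C i) \<and> diameter (C i) \<le> \<delta>"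
    define D where "D i = f ` (C i \<inter> A)" for i
    have dist_D: "dist x y \<le> L * diameter (C i)" if xy: "x \<in> D i" "y \<in> D i" for x y i
    proof -
      obtain u v where "u \<in> C i \<inter> A" "v \<in> C i \<inter> A" "x = f u" "y = f v" using xy by (auto simp: D_def)
      moreover then have "dist u v \<le> diameter (C i)" using C(2) by (intro diameter_bounded_bound) auto
      ultimately show ?thesis using f[of u v] L by (auto intro: order_trans)
    qed
    have diam: "diameter (D i) \<le> L * diameter (C i)" for i
      using L C(2) by (intro diameter_le_dist dist_D mult_nonneg_nonneg diameter_ge_0) auto
    have "bounded (D i)" for i
      unfolding bounded_two_points using dist_D by blast
    moreover have "diameter (D i) \<le> L * \<delta>" for i
      using diam[of i] C(2) L by (meson mult_le_cancel_left_pos order_trans)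
    moreover have "f ` A \<subseteq> (\<Union>i. D i)" using C(1) by (fastforce simp: D_def)
    ultimately have "hausdorff_content s (L * \<delta>) (f ` A) \<le> (suminf (\<lambda>i. ennreal (?c * diameter (D i) powr s)))"
      unfolding hausdorff_content_def by (intro INF_lower) auto
    also have "\<dots> \<le> (suminf (\<lambda>i. ennreal (L powr s) * ennreal (?c * diameter (C i) powr s)))"
    proof (intro suminf_le)
      fix i
      have "bounded (D i)" by fact
      then have "0 \<le> diameter (D i)" by (rule diameter_ge_0)
      then have "diameter (D i) powr s \<le> (L * diameter (C i)) powr s"
        using diam[of i] s by (intro powr_mono2) auto
      also have "\<dots> = L powr s * diameter (C i) powr s"
        by (rule powr_mult)
      finally have "?c * diameter (D i) powr s \<le> ?c * (L powr s * diameter (C i) powr s)"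
        using c by (rule mult_left_mono)
      also have "\<dots> = L powr s * (?c * diameter (C i) powr s)" by (rule mult.left_commute)
      finally have "?c * diameter (D i) powr s \<le> L powr s * (?c * diameter (C i) powr s)" .
      then show "ennreal (?c * diameter (D i) powr s) \<le> ennreal (L powr s) * ennreal (?c * diameter (C i) powr s)"
        unfolding ennreal_mult[OF powr_ge_zero mult_nonneg_nonneg[OF c powr_ge_zero], symmetric]
        by (rule ennreal_leI)
    qed auto
    also have "\<dots> = ennreal (L powr s) * (suminf (\<lambda>i. ennreal (?c * diameter (C i) powr s)))"
      by (rule ennreal_suminf_cmult)
    finally have "ennreal (1 / L powr s) * hausdorff_content s (L * \<delta>) (f ` A)
        \<le> ennreal (1 / L powr s) * (ennreal (L powr s) * (suminf (\<lambda>i. ennreal (?c * diameter (C i) powr s))))"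
      by (rule mult_left_mono) simp
    then show "ennreal (1 / L powr s) * hausdorff_content s (L * \<delta>) (f ` A)
        \<le> (suminf (\<lambda>i. ennreal (?c * diameter (C i) powr s)))"
      using inv by (simp only: mult.assoc[symmetric] mult.commute[of "ennreal (1 / L powr s)" "ennreal (L powr s)"] mult_1)
  qed
  then have "ennreal (L powr s) * (ennreal (1 / L powr s) * hausdorff_content s (L * \<delta>) (f ` A))
      \<le> ennreal (L powr s) * hausdorff_content s \<delta> A"
    by (rule mult_left_mono) simp
  then show ?thesis using inv by (simp only: mult.assoc[symmetric] mult_1)
qed

lemma hausdorff_outer_lipschitz_image:
  fixes f :: "'a::metric_space \<Rightarrow> 'b::metric_space"
  assumes "0 < s" "0 < L" "\<And>x y. x \<in> A \<Longrightarrow> y \<in> A \<Longrightarrow> dist (f x) (f y) \<le> L * dist x y"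
  shows "hausdorff_outer s (f ` A) \<le> ennreal (L powr s) * hausdorff_outer s A"
  unfolding hausdorff_outer_def[of s "f ` A"]
proof (rule SUP_least)
  fix \<delta> :: real assume \<delta>: "\<delta> \<in> {0<..}"
  have "hausdorff_content s (L * (\<delta> / L)) (f ` A) \<le> ennreal (L powr s) * hausdorff_content s (\<delta> / L) A"
    using assms \<delta> by (intro hausdorff_content_lipschitz_image) auto
  also have "\<dots> \<le> ennreal (L powr s) * hausdorff_outer s A"
    using assms \<delta> by (intro mult_left_mono hausdorff_content_le_outer) auto
  finally show "hausdorff_content s \<delta> (f ` A) \<le> ennreal (L powr s) * hausdorff_outer s A"
    using assms by simp
qed

text \<open>As balls about \<open>p\<close> have positive measure, this excludes a one-point space,
  in which no path leaves \<open>p\<close>.\<close>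

lemma hausdorff_outer_singleton: "hausdorff_outer s {x} = 0"
proof -
  have "hausdorff_content s \<delta> {x} \<le> 0" if "0 < \<delta>" for \<delta>
    unfolding hausdorff_content_def using that by (intro INF_lower2[of "\<lambda>_. {x}"]) auto
  then have "hausdorff_outer s {x} \<le> 0" unfolding hausdorff_outer_def by (intro SUP_least) auto
  then show ?thesis by simp
qed

text \<open>Since \<open>sinh (t * x) \<ge> t * x\<close>, the quotient in the factor is at least
  \<open>t * (x / sinh x)\<close>, and \<open>x / sinh x\<close> tends to 1 at 0. How small
  \<open>d\<close> has to be is therefore independent of \<open>t\<close>.\<close>

lemma mcp_factor_lower_bound:
  fixes K n \<delta> :: real
  assumes "K < 0" "1 \<le> n" "0 < \<delta>" "\<delta> < 1"
  shows "\<exists>r>0. \<forall>t\<in>{0<..1}. \<forall>d\<in>{0..r}. (1 - \<delta>) * t powr n \<le> mcp_factor K n t d"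
proof (cases "n = 1")
  case True
  then show ?thesis
    using assms by (intro exI[of _ 1]) (auto simp: mcp_factor_def mult_left_le_one_le)
next
  case False
  then have n: "1 < n" using assms by simp
  define \<kappa> where "\<kappa> = sqrt (- K / (n - 1))"
  have \<kappa>: "0 < \<kappa>" using assms n by (simp add: \<kappa>_def divide_neg_pos)
  \<comment> \<open>Chosen so that the exponent \<open>n - 1\<close> turns \<open>c\<close> into
    exactly \<open>1 - \<delta>\<close>.\<close>
  define c where "c = (1 - \<delta>) powr (1 / (n - 1))"
  have c: "0 < c" "c powr (n - 1) = 1 - \<delta>" using assms n by (auto simp: c_def powr_powr)
  have "c < 1 powr (1 / (n - 1))" unfolding c_def using assms n by (intro powr_less_mono2) auto
  then have "c < 1" by simp
  have "((\<lambda>x::real. x / sinh x) \<longlongrightarrow> 1) (at_right 0)"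
    by real_asymp
  from order_tendstoD(1)[OF this \<open>c < 1\<close>]
  obtain b where b: "0 < b" "\<And>x. 0 < x \<Longrightarrow> x < b \<Longrightarrow> c < x / sinh x"
    by (auto simp: eventually_at_right_field)
  have x_sinh: "x \<le> sinh x" if "0 \<le> x" for x :: real
    using real_le_x_sinh[OF that] by (simp add: sinh_field_def exp_minus)
  show ?thesis
  proof (intro exI[of _ "b / (2 * \<kappa>)"] conjI ballI)
    show "0 < b / (2 * \<kappa>)" using b \<kappa> by simp
    fix t d :: real assume t: "t \<in> {0<..1}" and d: "d \<in> {0..b / (2 * \<kappa>)}"
    have tn: "t * t powr (n - 1) = t powr n" using t powr_mult_base[of t "n - 1"] by simp
    show "(1 - \<delta>) * t powr n \<le> mcp_factor K n t d"
    proof (cases "d = 0")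
      case True
      then show ?thesis using False tn assms by (simp add: mcp_factor_def mult_left_le_one_le)
    next
      case d0: False
      define x where "x = d * \<kappa>"
      have "d * \<kappa> \<le> b / 2" using d \<kappa> by (simp add: field_simps)
      then have x: "0 < x" "x < b" using d d0 \<kappa> b by (auto simp: x_def)
      have "t * c \<le> t * (x / sinh x)" using b(2)[OF x] t by (intro mult_left_mono) auto
      also have "\<dots> \<le> sinh (t * x) / sinh x"
        using x_sinh[of "t * x"] x t by (simp add: divide_right_mono)
      finally have "(t * c) powr (n - 1) \<le> (sinh (t * x) / sinh x) powr (n - 1)"
        using t c n by (intro powr_mono2) auto
      then have "t * (t powr (n - 1) * (1 - \<delta>)) \<le> t * (sinh (t * x) / sinh x) powr (n - 1)"
        using t c by (intro mult_left_mono) (auto simp: powr_mult)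
      moreover have "mcp_factor K n t d = t * (sinh (t * x) / sinh x) powr (n - 1)"
        using False d0 by (simp add: mcp_factor_def x_def \<kappa>_def mult.assoc)
      moreover have "t * (t powr (n - 1) * (1 - \<delta>)) = (1 - \<delta>) * t powr n"
        unfolding tn[symmetric] by simp
      ultimately show ?thesis by simp
    qed
  qed
qed

section \<open>From the restricted measure to the whole space\<close>

lemma metric_measure_space_closed:
  "metric_measure_space m \<Longrightarrow> closed (space m)"
  by (simp add: metric_measure_space_def complete_imp_closed)

text \<open>The neighbourhood of finite measure is open only relative to \<open>U\<close>;
  intersecting with \<open>interior U\<close> yields a genuine ball. Completeness makes
  \<open>U\<close> closed, hence measurable, so the restricted measure agrees with \<open>m\<close>
  on its measurable subsets.\<close>

lemma locally_finite_ball: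
  fixes m :: "'a::metric_space measure"
  assumes m: "sets m = sets borel" and U: "metric_measure_space (restrict_space m U)" "p \<in> interior U"
  shows "\<exists>r>0. emeasure m (ball p r) < \<infinity>"
proof -
  have sp: "space (restrict_space m U) = U" using m by (simp add: space_restrict_space sets_eq_imp_space_eq)
  have "closed U" using metric_measure_space_closed[OF U(1)] by (simp add: sp)
  then have "U \<in> sets m" using m by simp
  have "p \<in> U" using U(2) interior_subset by auto
  then obtain V where V: "openin (top_of_set U) V" "p \<in> V" "emeasure (restrict_space m U) V < \<infinity>"
    using U(1) unfolding metric_measure_space_def sp by blast
  obtain T where T: "open T" "V = U \<inter> T" using V(1) by (auto simp: openin_open)
  have "open (interior U \<inter> T)" "p \<in> interior U \<inter> T" using T V(2) U(2) by auto
  then obtain r where r: "0 < r" "ball p r \<subseteq> interior U \<inter> T" by (meson open_contains_ball)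
  have "ball p r \<subseteq> V" using r(2) T(2) interior_subset[of U] by auto
  have "V \<subseteq> U" "V \<in> sets m" using T \<open>closed U\<close> m by auto
  then have "emeasure m V < \<infinity>"
    using V(3) \<open>U \<in> sets m\<close> by (simp add: emeasure_restrict_space)
  then show ?thesis
    using r(1) emeasure_mono[OF \<open>ball p r \<subseteq> V\<close> \<open>V \<in> sets m\<close>] by (intro exI[of _ r]) (auto simp: less_le_trans le_less_trans)
qed

lemma locally_positive_ball:
  fixes m :: "'a::metric_space measure"
  assumes m: "sets m = sets borel" and U: "metric_measure_space (restrict_space m U)" "p \<in> U" and "0 < r"
  shows "0 < emeasure m (ball p r)"
proof -
  have sp: "space (restrict_space m U) = U" using m by (simp add: space_restrict_space sets_eq_imp_space_eq)
  have "closed U" using metric_measure_space_closed[OF U(1)] by (simp add: sp)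
  then have "U \<in> sets m" using m by simp
  have "openin (top_of_set U) (U \<inter> ball p r)" "U \<inter> ball p r \<noteq> {}" using U(2) \<open>0 < r\<close> by auto
  then have "0 < emeasure (restrict_space m U) (U \<inter> ball p r)"
    using U(1) unfolding metric_measure_space_def sp by blast
  also have "\<dots> = emeasure m (U \<inter> ball p r)"
    using \<open>U \<in> sets m\<close> by (subst emeasure_restrict_space) auto
  also have "\<dots> \<le> emeasure m (ball p r)" using m by (intro emeasure_mono) auto
  finally show ?thesis .
qed

text \<open>The contracted set need not be Borel, so its outer measure is compared with a Borel set
  \<open>B\<close> containing it. Points of \<open>A\<close> lie within \<open>2 * \<rho>\<close> of
  \<open>q\<close>, which is the range of the factor bound, and the paths to them stay in
  \<open>ball p (3 * \<rho>)\<close>.\<close>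

lemma mcp_contraction_measure:
  fixes m :: "'a::metric_space measure"
  assumes m: "sets m = sets borel" and geo: "geodesic_space (UNIV :: 'a set)"
    and U: "mcp K n (restrict_space m U)" "ball p (3 * \<rho>) \<subseteq> U" and "0 < \<rho>" and "K \<le> 0" and "\<delta> < 1" "0 < \<delta>"
    and factor: "K < 0 \<Longrightarrow> \<forall>t\<in>{0<..1}. \<forall>d\<in>{0..2 * \<rho>}. (1 - \<delta>) * t powr n \<le> mcp_factor K n t d"
    and q: "q \<in> ball p \<rho>" and A: "A \<in> sets borel" "A \<subseteq> ball p \<rho>" "emeasure m A < \<infinity>"
    and B: "B \<in> sets borel" "\<And>x z. x \<in> A \<Longrightarrow> intermediate q t x z \<Longrightarrow> z \<in> B" and t: "0 < t" "t \<le> 1"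
  shows "ennreal ((1 - \<delta>) * t powr n) * emeasure m A \<le> emeasure m B"
proof (cases "emeasure m A = 0")
  \<comment> \<open>\<open>mcp\<close> speaks only of sets of positive measure.\<close>
  case True then show ?thesis by simp
next
  case False
  let ?M = "restrict_space m U"
  have sp: "space ?M = U" using m by (simp add: space_restrict_space sets_eq_imp_space_eq)
  have U': "metric_measure_space ?M" "uniquely_geodesic_space U" using U(1) by (simp_all add: mcp_def sp)
  have "closed U" using metric_measure_space_closed[OF U'(1)] by (simp add: sp)
  then have "U \<in> sets m" using m by simp
  have AU: "A \<subseteq> U" using A(2) U(2) \<open>0 < \<rho>\<close> by fastforce
  have eA: "emeasure ?M A = emeasure m A"
    using AU \<open>U \<in> sets m\<close> by (intro emeasure_restrict_space) auto
  have AM: "A \<in> sets ?M" using A(1) m AU \<open>U \<in> sets m\<close> by (subst sets_restrict_space_iff) auto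
  have qU: "q \<in> U" using q U(2) \<open>0 < \<rho>\<close> by fastforce
  have near: "dist q x < 2 * \<rho>" if "x \<in> A" for x
    using A(2) that q dist_triangle[of q x p] by (fastforce simp: dist_commute)
  have "intermediate_point U q t ` A \<subseteq> B \<inter> U"
  proof clarify
    fix x assume x: "x \<in> A"
    obtain \<gamma> where \<gamma>: "shortest_path_from_to UNIV q x \<gamma>" using geo unfolding geodesic_space_def by blast
    then have z: "intermediate q t x (\<gamma> (t * dist q x))"
      using shortest_path_intermediate[of UNIV "dist q x" \<gamma> "dist q x" t] t by (auto simp: shortest_path_from_to_def)
    have in_U: "y \<in> U" if "dist q y \<le> dist q x" for y
    proof -
      have "dist p y < 3 * \<rho>" using that near[OF x] q dist_triangle[of p y q] by simp
      then show ?thesis using U(2) by auto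
    qed
    have "intermediate_point U q t x = \<gamma> (t * dist q x)"
      using qU AU x t z in_U by (intro intermediate_point_eq[OF geo U'(2)]) auto
    then show "intermediate_point U q t x \<in> B \<inter> U"
      using B(2)[OF x z] in_U[OF intermediate_dist_le[OF z]] by simp
  qed
  then have "outer_measure_of ?M (intermediate_point U q t ` A) \<le> outer_measure_of ?M (B \<inter> U)"
    by (rule outer_measure_of_mono)
  also have "B \<inter> U \<in> sets ?M" using B(1) m \<open>U \<in> sets m\<close> by (subst sets_restrict_space_iff) auto
  then have "outer_measure_of ?M (B \<inter> U) = emeasure ?M (B \<inter> U)" by (rule outer_measure_of_eq)
  also have "\<dots> = emeasure m (B \<inter> U)" using \<open>U \<in> sets m\<close> by (intro emeasure_restrict_space) auto
  also have "\<dots> \<le> emeasure m B" using B(1) m by (intro emeasure_mono) auto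
  finally have upper: "outer_measure_of ?M (intermediate_point U q t ` A) \<le> emeasure m B" .
  have "(if K = 0 then ennreal (t powr n) * emeasure ?M A
         else \<integral>\<^sup>+x\<in>A. ennreal (mcp_factor K n t (dist q x)) \<partial>?M)
        \<le> outer_measure_of ?M (intermediate_point U q t ` A)"
    using U(1) qU AM t False A(3) eA unfolding mcp_def sp by (auto simp: zero_less_iff_neq_zero)
  moreover have "ennreal ((1 - \<delta>) * t powr n) * emeasure m A \<le> (if K = 0 then ennreal (t powr n) * emeasure ?M A
         else \<integral>\<^sup>+x\<in>A. ennreal (mcp_factor K n t (dist q x)) \<partial>?M)"
  proof (cases "K = 0")
    case True
    have "(1 - \<delta>) * t powr n \<le> t powr n" using \<open>0 < \<delta>\<close> \<open>\<delta> < 1\<close> by (simp add: mult_left_le_one_le)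
    then show ?thesis using True eA by (auto intro!: mult_right_mono ennreal_leI)
  next
    case False
    then have "K < 0" using \<open>K \<le> 0\<close> by simp
    have "ennreal ((1 - \<delta>) * t powr n) * emeasure ?M A = (\<integral>\<^sup>+x. ennreal ((1 - \<delta>) * t powr n) * indicator A x \<partial>?M)"
      by (rule nn_integral_cmult_indicator[OF AM, symmetric])
    also have "\<dots> \<le> (\<integral>\<^sup>+x\<in>A. ennreal (mcp_factor K n t (dist q x)) \<partial>?M)"
    proof (intro nn_integral_mono)
      fix x
      show "ennreal ((1 - \<delta>) * t powr n) * indicator A x \<le> ennreal (mcp_factor K n t (dist q x)) * indicator A x"
      proof (cases "x \<in> A")
        case True
        then have "(1 - \<delta>) * t powr n \<le> mcp_factor K n t (dist q x)"
          using factor[OF \<open>K < 0\<close>] t near[OF True] by auto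
        then show ?thesis by (intro mult_right_mono ennreal_leI) auto
      qed simp
    qed
    finally show ?thesis using False eA by simp
  qed
  ultimately show ?thesis using upper by (meson order_trans)
qed

section \<open>Volumes of balls\<close>

lemma ball_subset_triangle:
  fixes x y :: "'a::metric_space"
  assumes "dist x y + r \<le> s"
  shows "ball x r \<subseteq> ball y s"
proof
  fix z assume "z \<in> ball x r"
  then show "z \<in> ball y s" using assms dist_triangle[of y z x] by (simp add: dist_commute)
qed

section \<open>Extension of shortest paths to a uniform length\<close>

locale extensible_ball = contracting_ball p \<rho> for p :: "'a::metric_space" and \<rho> :: real +
  assumes local_ext: "\<And>q x. q \<in> ball p \<rho> \<Longrightarrow> x \<in> ball p \<rho> \<Longrightarrow> q \<noteq> x \<Longrightarrow> \<exists>y. y \<noteq> x \<and> lies_between q x y"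
begin

text \<open>If a maximal extension ended before length \<open>L\<close>, a local extension, cut so
  as not to exceed \<open>L\<close>, would contradict maximality.\<close>

lemma uniform_extension:
  assumes q: "dist p q + L < \<rho>" and x: "q \<noteq> x" "dist q x \<le> L"
  shows "\<exists>z. lies_between q x z \<and> dist q z = L"
proof -
  obtain z where z: "lies_between q x z" "dist q z \<le> L"
    and max: "\<And>w. lies_between q z w \<Longrightarrow> dist q w \<le> L \<Longrightarrow> w = z"
    using maximal_extension[OF complete_UNIV x(2)] by blast
  have "dist q z = L"
  proof (rule ccontr)
    assume "dist q z \<noteq> L"
    then have "dist q z < L" using z(2) by simp
    have "0 < dist q z" using z(1) x(1) by (simp add: lies_between_def add_pos_nonneg)
    have "q \<in> ball p \<rho>" "z \<in> ball p \<rho>"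
      using q z(2) dist_triangle[of p z q] x(2) zero_le_dist[of q x] unfolding mem_ball by linarith+
    then obtain y where y: "y \<noteq> z" "lies_between q z y" using local_ext \<open>0 < dist q z\<close> by force
    \<comment> \<open>The cut: \<open>s * dist z y\<close> is at most the length that remains up to
      \<open>L\<close>.\<close>
    define s where "s = min 1 ((L - dist q z) / dist z y)"
    have s: "0 < s" "s \<le> 1" using y(1) \<open>dist q z < L\<close> by (auto simp: s_def)
    then obtain w where w: "intermediate z s y w" using intermediate_exists[of s z y] by auto
    have "dist z w = s * dist z y" using w by (simp add: intermediate_def)
    also have "\<dots> \<le> (L - dist q z) / dist z y * dist z y" unfolding s_def by (intro mult_right_mono) auto
    also have "\<dots> = L - dist q z" using y(1) by simp
    finally have "dist z w \<le> L - dist q z" .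
    moreover have "lies_between q z w" using lies_between_intermediate[OF y(2) w] .
    ultimately have "w = z" by (intro max) (auto simp: lies_between_def)
    then show False using w s y(1) by (simp add: intermediate_def)
  qed
  then show ?thesis using z(1) by blast
qed

end

locale volume_ball = extensible_ball p \<rho> for p :: "'a::metric_space" and \<rho> :: real +
  fixes n \<delta> :: real
  assumes n: "1 \<le> n" and \<delta>: "0 < \<delta>" "\<delta> < 1"
    and finite_volume: "emeasure (hausdorff_measure n) (ball p \<rho>) < \<infinity>"
    and positive_volume: "\<And>r. 0 < r \<Longrightarrow> 0 < emeasure (hausdorff_measure n) (ball p r)"
    and mcp_volume: "\<And>q A B t. q \<in> ball p \<rho> \<Longrightarrow> A \<in> sets borel \<Longrightarrow> A \<subseteq> ball p \<rho> \<Longrightarrow> B \<in> sets borel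
      \<Longrightarrow> (\<And>x z. x \<in> A \<Longrightarrow> intermediate q t x z \<Longrightarrow> z \<in> B) \<Longrightarrow> 0 < t \<Longrightarrow> t \<le> 1 \<Longrightarrow> emeasure (hausdorff_measure n) A < \<infinity>
      \<Longrightarrow> ennreal ((1 - \<delta>) * t powr n) * emeasure (hausdorff_measure n) A \<le> emeasure (hausdorff_measure n) B"
begin

abbreviation "H \<equiv> hausdorff_measure n :: 'a measure"

definition V :: "'a \<Rightarrow> real \<Rightarrow> real" where "V x r = measure H (ball x r)"

lemma finite_H: "A \<subseteq> ball p \<rho> \<Longrightarrow> emeasure H A < \<infinity>"
  using finite_volume emeasure_mono[of A "ball p \<rho>" H] by (auto intro: le_less_trans)

lemma fmeasurable_H: "A \<in> sets borel \<Longrightarrow> A \<subseteq> ball p \<rho> \<Longrightarrow> A \<in> fmeasurable H"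
  using finite_H by (auto intro: fmeasurableI)

lemma measure_mcp:
  assumes "q \<in> ball p \<rho>" "A \<in> sets borel" "A \<subseteq> ball p \<rho>" "B \<in> sets borel" "B \<subseteq> ball p \<rho>"
    "\<And>x z. x \<in> A \<Longrightarrow> intermediate q t x z \<Longrightarrow> z \<in> B" "0 < t" "t \<le> 1"
  shows "(1 - \<delta>) * t powr n * measure H A \<le> measure H B"
proof -
  have fin: "emeasure H A = ennreal (measure H A)" "emeasure H B = ennreal (measure H B)"
    using finite_H[OF assms(3)] finite_H[OF assms(5)] by (auto intro!: emeasure_eq_ennreal_measure)
  have "ennreal ((1 - \<delta>) * t powr n) * emeasure H A \<le> emeasure H B"
    using assms finite_H by (intro mcp_volume) auto
  then show ?thesis
    using \<delta> by (simp add: fin ennreal_mult[symmetric] del: ennreal_le_iff) (simp add: ennreal_le_iff)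
qed

text \<open>The image of \<open>A\<close> need not be Borel, so the estimate runs through the outer
  measure, which agrees with the measure on \<open>A\<close> and \<open>B\<close>.\<close>

lemma measure_lipschitz_image:
  assumes "A \<in> sets borel" "A \<subseteq> ball p \<rho>" "B \<in> sets borel" "B \<subseteq> f ` A" "0 < t"
    "\<And>x y. x \<in> A \<Longrightarrow> y \<in> A \<Longrightarrow> dist (f x) (f y) \<le> t * dist x y"
  shows "measure H B \<le> t powr n * measure H A"
proof -
  have "emeasure H B = hausdorff_outer n B" using assms by (intro emeasure_hausdorff_measure)
  also have "\<dots> \<le> hausdorff_outer n (f ` A)" using assms(4) by (rule hausdorff_outer_mono)
  also have "\<dots> \<le> ennreal (t powr n) * hausdorff_outer n A"
    using assms n by (intro hausdorff_outer_lipschitz_image) auto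
  also have "hausdorff_outer n A = emeasure H A" using assms by (intro emeasure_hausdorff_measure[symmetric])
  also have "\<dots> = ennreal (measure H A)"
    using finite_H[OF assms(2)] by (auto intro!: emeasure_eq_ennreal_measure)
  also have "ennreal (t powr n) * ennreal (measure H A) = ennreal (t powr n * measure H A)"
    by (rule ennreal_mult[symmetric]) auto
  finally show ?thesis unfolding measure_def by (intro enn2real_leI) auto
qed

lemma V_mono: "ball x r \<subseteq> ball y s \<Longrightarrow> ball y s \<subseteq> ball p \<rho> \<Longrightarrow> V x r \<le> V y s"
  unfolding V_def by (rule measure_mono_fmeasurable) (auto intro: fmeasurable_H)

lemma ball_subset: "dist p x + r \<le> s \<Longrightarrow> ball x r \<subseteq> ball p s"
  by (rule ball_subset_triangle) (simp add: dist_commute)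

lemma V_contract_ge:
  assumes "dist p x + r \<le> \<rho>" "0 < r" "0 < t" "t \<le> 1"
  shows "(1 - \<delta>) * t powr n * V x r \<le> V x (t * r)"
  unfolding V_def
proof (rule measure_mcp)
  have *: "t * r \<le> r" using assms by (simp add: mult_left_le_one_le)
  show "ball x r \<subseteq> ball p \<rho>" "ball x (t * r) \<subseteq> ball p \<rho>"
    using assms(1) * by (intro ball_subset; linarith)+
  show "x \<in> ball p \<rho>" using assms by simp
  show "z \<in> ball x (t * r)" if "y \<in> ball x r" "intermediate x t y z" for y z
    using that assms by (simp add: intermediate_def)
qed (use assms in auto)

text \<open>The Lipschitz estimate applies because \<open>contract x t\<close> covers the smaller
  ball: a point \<open>z\<close> of it lies on a shortest path from \<open>x\<close> that extends to
  length \<open>dist x z / t\<close>, which is less than \<open>r\<close>.\<close>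

lemma V_contract_le:
  assumes "dist p x + r < \<rho>" "0 < r" "0 < t" "t \<le> 1"
  shows "V x (t * r) \<le> t powr n * V x r"
  unfolding V_def
proof (rule measure_lipschitz_image)
  have x: "x \<in> ball p \<rho>" using assms by simp
  have sub: "ball x r \<subseteq> ball p \<rho>" using assms by (intro ball_subset) auto
  then show "ball x r \<subseteq> ball p \<rho>" .
  show "ball x (t * r) \<subseteq> contract x t ` ball x r"
  proof
    fix z assume z: "z \<in> ball x (t * r)"
    show "z \<in> contract x t ` ball x r"
    proof (cases "z = x")
      case True
      have "dist x (contract x t x) = t * dist x x" using contract_intermediate[of t x x] assms unfolding intermediate_def by simp
      then have "contract x t x = x" by simp
      then show ?thesis using True assms by (intro image_eqI[of _ _ x]) auto
    next
      case False
      define L where "L = dist x z / t"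
      have L: "dist x z \<le> L" "L < r" using z assms False by (auto simp: L_def field_simps mult_left_le_one_le)
      have "0 < dist x z" using False by simp
      obtain y where y: "lies_between x z y" "dist x y = L"
        using uniform_extension[of x L z] assms L False by auto
      have "x \<noteq> y" using y L \<open>0 < dist x z\<close> by auto
      have "dist x z / dist x y = t" using y(2) assms \<open>0 < dist x z\<close> by (simp add: L_def)
      then have "intermediate x t y z" using lies_between_imp_intermediate[OF y(1) \<open>x \<noteq> y\<close>] by simp
      moreover have "y \<in> ball x r" using y L by simp
      ultimately have "contract x t y = z" using x sub assms by (intro contract_eq) auto
      then show ?thesis using \<open>y \<in> ball x r\<close> by blast
    qed
  qed
  show "dist (contract x t y) (contract x t z) \<le> t * dist y z" if "y \<in> ball x r" "z \<in> ball x r" for y z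
    using x sub that assms by (intro contraction[of x y z t] contract_intermediate) auto
qed (use assms in auto)

text \<open>
  For a fixed centre the volume ratios at different scales are compared by contraction (one way)
  and by extension (the other way); different centres are compared at the single scale \<open>\<rho> / 4\<close>
  with \<open>p\<close>, so that no density theorem for the Hausdorff measure is needed.
\<close>

lemma uniform_volume:
  assumes \<eta>: "0 < \<eta>" "\<eta> \<le> 1" "\<delta> \<le> \<eta> / 4"
  shows "\<exists>R \<theta>. 0 < R \<and> R \<le> \<rho> / 8 \<and> 0 < \<theta> \<and> (\<forall>x\<in>ball p R. \<forall>r\<in>{0<..R}.
    (1 - \<eta>) * \<theta> * r powr n \<le> V x r \<and> V x r \<le> (1 + \<eta>) * \<theta> * r powr n)"
proof -
  \<comment> \<open>A quarter of \<open>\<rho>\<close> leaves room for balls of radius up to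
    \<open>(1 + c) * r0\<close> and for moved centres.\<close>
  define r0 where "r0 = \<rho> / 4"
  have r0: "0 < r0" using radius_pos by (simp add: r0_def)
  have "((\<lambda>c. (1 + c) powr n) \<longlongrightarrow> (1 + 0) powr n) (at_right 0)"
    "((\<lambda>c. (1 - c) powr n) \<longlongrightarrow> (1 - 0) powr n) (at_right 0)"
    by (intro tendsto_intros; simp)+
  then have "\<forall>\<^sub>F c in at_right 0. (1 + c) powr n < 1 + \<eta> / 2" "\<forall>\<^sub>F c in at_right 0. 1 - \<eta> / 2 < (1 - c) powr n"
    using \<eta> by (auto intro: order_tendstoD)
  moreover have "\<forall>\<^sub>F c in at_right 0. c < (1/2 :: real)"
    by (intro order_tendstoD(2)[OF tendsto_ident_at]) auto
  moreover have "\<forall>\<^sub>F c in at_right 0. (0::real) < c"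
    by (simp add: eventually_at_right_less)
  ultimately have "\<forall>\<^sub>F c in at_right 0. (1 + c) powr n < 1 + \<eta> / 2 \<and> 1 - \<eta> / 2 < (1 - c) powr n \<and> c < 1/2 \<and> 0 < c"
    by eventually_elim auto
  \<comment> \<open>\<open>c\<close> is a relative change of radius whose effect on
    \<open>r powr n\<close> is a proportion below \<open>\<eta> / 2\<close>.\<close>
  then obtain c where c: "(1 + c) powr n < 1 + \<eta> / 2" "1 - \<eta> / 2 < (1 - c) powr n" "c < 1/2" "0 < c"
    using eventually_happens'[OF trivial_limit_at_right_real] by blast
  \<comment> \<open>Moving a centre by less than \<open>c * r0\<close> is absorbed by changing the
    radius \<open>r0\<close> by the factor \<open>1 + c\<close> or \<open>1 - c\<close>.\<close>
  define R where "R = c * r0"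
  define \<theta> where "\<theta> = V p r0 / r0 powr n"
  have R: "0 < R" "R \<le> \<rho> / 8" "R \<le> r0" using c r0 by (auto simp: R_def r0_def mult_left_le_one_le)
  have "0 < V p r0"
  proof -
    have "emeasure H (ball p r0) = ennreal (V p r0)"
      unfolding V_def using finite_H[OF ball_subset] radius_pos
      by (intro emeasure_eq_ennreal_measure) (auto simp: r0_def less_top)
    then show ?thesis using positive_volume[OF r0] by simp
  qed
  then have \<theta>: "0 < \<theta>" "V p r0 = \<theta> * r0 powr n" using r0 by (auto simp: \<theta>_def)
  have upper0: "(1 - \<delta>) * V x r0 \<le> (1 + c) powr n * V p r0" if "x \<in> ball p R" for x
  proof -
    have "V x r0 \<le> V p ((1 + c) * r0)"
    proof (rule V_mono)
      show "ball x r0 \<subseteq> ball p ((1 + c) * r0)" using that by (intro ball_subset) (auto simp: R_def algebra_simps)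
      show "ball p ((1 + c) * r0) \<subseteq> ball p \<rho>"
        using c r0 radius_pos by (intro ball_subset) (auto simp: r0_def field_simps)
    qed
    then have "(1 - \<delta>) * V x r0 \<le> (1 - \<delta>) * V p ((1 + c) * r0)" using \<delta> by (intro mult_left_mono) auto
    also have "\<dots> = (1 + c) powr n * ((1 - \<delta>) * (1 / (1 + c)) powr n * V p ((1 + c) * r0))"
      using c by (simp add: powr_divide)
    also have "\<dots> \<le> (1 + c) powr n * V p (1 / (1 + c) * ((1 + c) * r0))"
      using c r0 by (intro mult_left_mono V_contract_ge) (auto simp: r0_def)
    also have "1 / (1 + c) * ((1 + c) * r0) = r0" using c by simp
    finally show ?thesis .
  qed
  have lower0: "(1 - \<delta>) * (1 - c) powr n * V p r0 \<le> V x r0" if "x \<in> ball p R" for x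
  proof -
    have "(1 - \<delta>) * (1 - c) powr n * V p r0 \<le> V p ((1 - c) * r0)"
      using c r0 by (intro V_contract_ge) (auto simp: r0_def)
    also have "\<dots> \<le> V x r0"
    proof (rule V_mono)
      show "ball p ((1 - c) * r0) \<subseteq> ball x r0"
        using that c r0 by (intro ball_subset_triangle) (auto simp: R_def algebra_simps)
      show "ball x r0 \<subseteq> ball p \<rho>" using that R by (intro ball_subset) (auto simp: r0_def)
    qed
    finally show ?thesis .
  qed
  show ?thesis
  proof (rule exI[of _ R], rule exI[of _ \<theta>], intro conjI ballI R(1,2) \<theta>(1))
    fix x r assume x: "x \<in> ball p R" and "r \<in> {0<..R}"
    then have r: "0 < r" "r \<le> R" by auto
    have xr: "dist p x + r0 < \<rho>" using x R by (simp add: r0_def)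
    define t where "t = r / r0"
    have t: "0 < t" "t \<le> 1" "t * r0 = r" using r r0 R by (auto simp: t_def)
    have tr: "t powr n * r0 powr n = r powr n" using t r0 by (simp add: powr_mult[symmetric])
    \<comment> \<open>Measure contraction enters the lower bound twice, once about \<open>p\<close>
      and once about \<open>x\<close>, at the price of one factor \<open>1 - \<delta>\<close>
      each.\<close>
    have d1: "(1 - \<delta>)\<^sup>2 \<ge> 1 - \<eta> / 2" using \<eta> by (simp add: power2_eq_square algebra_simps) (use zero_le_square[of \<delta>] in linarith)
    have "(1 - \<eta>) \<le> (1 - \<eta> / 2) * (1 - \<eta> / 2)" by (simp add: algebra_simps)
    also have "\<dots> \<le> (1 - \<delta>)\<^sup>2 * (1 - c) powr n" using d1 c \<eta> by (intro mult_mono) auto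
    finally have "(1 - \<eta>) * (\<theta> * r powr n) \<le> ((1 - \<delta>)\<^sup>2 * (1 - c) powr n) * (\<theta> * r powr n)"
      using \<theta> by (intro mult_right_mono) auto
    also have "\<dots> = (1 - \<delta>) * t powr n * ((1 - \<delta>) * (1 - c) powr n * V p r0)"
      unfolding \<theta>(2) tr[symmetric] by (simp add: power2_eq_square)
    also have "\<dots> \<le> (1 - \<delta>) * t powr n * V x r0"
      using \<delta> by (intro mult_left_mono lower0 x) auto
    also have "\<dots> \<le> V x (t * r0)" using xr r0 t by (intro V_contract_ge) auto
    finally show "(1 - \<eta>) * \<theta> * r powr n \<le> V x r" using t by (simp add: mult.assoc)
    \<comment> \<open>The upper bound uses the Lipschitz estimate about \<open>x\<close>; its single
      factor \<open>1 - \<delta>\<close> comes from comparing two radii about \<open>p\<close> in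
      \<open>upper0\<close>.\<close>
    have "(1 - \<delta>) * V x r \<le> (1 - \<delta>) * (t powr n * V x r0)"
      using V_contract_le[OF xr r0 t(1,2)] \<delta> by (intro mult_left_mono) (auto simp: t)
    also have "\<dots> = t powr n * ((1 - \<delta>) * V x r0)" by simp
    also have "\<dots> \<le> t powr n * ((1 + c) powr n * V p r0)"
      by (intro mult_left_mono upper0 x) auto
    also have "\<dots> = (1 + c) powr n * (\<theta> * r powr n)" unfolding \<theta>(2) tr[symmetric] by simp
    also have "\<dots> \<le> ((1 - \<delta>) * (1 + \<eta>)) * (\<theta> * r powr n)"
    proof (intro mult_right_mono)
      have "\<delta> * (1 + \<eta>) \<le> \<eta> / 4 * (1 + \<eta>)" using \<eta> by (intro mult_right_mono) auto
      also have "\<dots> \<le> \<eta> / 4 * 2" using \<eta> by (intro mult_left_mono) auto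
      finally have "1 + \<eta> / 2 \<le> (1 - \<delta>) * (1 + \<eta>)" by (simp add: algebra_simps)
      then show "(1 + c) powr n \<le> (1 - \<delta>) * (1 + \<eta>)" using c by linarith
    qed (use \<theta> in auto)
    finally have "(1 - \<delta>) * V x r \<le> (1 - \<delta>) * ((1 + \<eta>) * \<theta> * r powr n)" by (simp add: mult.assoc)
    then show "V x r \<le> (1 + \<eta>) * \<theta> * r powr n" using \<delta> by simp
  qed
qed

text \<open>
  Suppose that \<open>x, y\<close> at distance \<open>2 s\<close> are contracted too much.  The disjoint balls of radius \<open>s\<close>
  around them are mapped into two balls of radius \<open>t s\<close> that share a ball of radius \<open>\<epsilon> t s\<close>, so
  the union of the images has too little volume.  With \<open>\<eta> = \<epsilon> powr n / 24\<close> the loss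
  \<open>24 \<eta>\<close> (in units of the volume \<open>P\<close> of a ball of radius \<open>t s\<close>) exceeds all error terms, which
  add up to at most \<open>6 \<eta>\<close>.
\<close>

lemma contraction_almost_isometric:
  assumes \<epsilon>: "0 < \<epsilon>" "\<epsilon> \<le> 1" and \<delta>': "\<delta> \<le> \<epsilon> powr n / 96"
  shows "\<exists>R>0. R \<le> \<rho> / 8 \<and> (\<forall>x\<in>ball p R. \<forall>y\<in>ball p R. \<forall>x' y'. \<forall>t\<in>{0<..1}.
    intermediate p t x x' \<longrightarrow> intermediate p t y y' \<longrightarrow> (1 - \<epsilon>) * (t * dist x y) \<le> dist x' y')"
proof -
  define \<eta> where "\<eta> = \<epsilon> powr n / 24"
  have "\<epsilon> powr n \<le> 1 powr n" using \<epsilon> n by (intro powr_mono2) auto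
  then have \<eta>: "0 < \<eta>" "\<eta> \<le> 1/24" "\<delta> \<le> \<eta> / 4" using \<epsilon> \<delta>' by (auto simp: \<eta>_def)
  then obtain R \<theta> where R: "0 < R" "R \<le> \<rho> / 8" and \<theta>: "0 < \<theta>"
    and lo: "\<And>x r. x \<in> ball p R \<Longrightarrow> 0 < r \<Longrightarrow> r \<le> R \<Longrightarrow> (1 - \<eta>) * \<theta> * r powr n \<le> V x r"
    and up: "\<And>x r. x \<in> ball p R \<Longrightarrow> 0 < r \<Longrightarrow> r \<le> R \<Longrightarrow> V x r \<le> (1 + \<eta>) * \<theta> * r powr n"
    using uniform_volume[of \<eta>] by force
  show ?thesis
  \<comment> \<open>The quarter keeps \<open>s\<close> below \<open>R / 4\<close> and the midpoint
    \<open>m\<close> in \<open>ball p R\<close>, where the volume bounds hold.\<close>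
  proof (intro exI[of _ "R / 4"] conjI ballI allI impI)
    show "0 < R / 4" "R / 4 \<le> \<rho> / 8" using R by auto
    fix x y x' y' t
    assume x: "x \<in> ball p (R / 4)" and y: "y \<in> ball p (R / 4)" and "t \<in> {0<..1}"
      and x': "intermediate p t x x'" and y': "intermediate p t y y'"
    then have t: "0 < t" "t \<le> 1" by auto
    show "(1 - \<epsilon>) * (t * dist x y) \<le> dist x' y'"
    proof (rule ccontr)
      assume "\<not> ?thesis"
      then have less: "dist x' y' < (1 - \<epsilon>) * (t * dist x y)" by simp
      define s where "s = dist x y / 2"
      have "x \<noteq> y" using less by auto
      then have s: "0 < s" "dist x y = 2 * s" by (auto simp: s_def)
      have "dist x y \<le> dist p x + dist p y" using dist_triangle[of x y p] by (simp add: dist_commute)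
      then have sR: "s < R / 4" using x y s(2) by simp
      have ts: "0 < t * s" "t * s \<le> s" using s t by (auto simp: mult_left_le_one_le)
      have px': "dist p x' < R / 4" "dist p y' < R / 4"
        using intermediate_dist_le[OF x'] intermediate_dist_le[OF y'] x y by auto
      \<comment> \<open>\<open>x'\<close> and \<open>y'\<close> are closer than
        \<open>(1 - \<epsilon>) * (t * s)\<close> to their midpoint, so the ball of radius
        \<open>\<epsilon> * (t * s)\<close> about \<open>m\<close> lies in both image balls.\<close>
      obtain m where m: "intermediate x' (1/2) y' m" using intermediate_exists[of "1/2" x' y'] by auto
      have m': "dist x' m = dist x' y' / 2" "dist m y' = dist x' y' / 2" using m by (auto simp: intermediate_def)
      have d': "dist x' y' / 2 < (1 - \<epsilon>) * (t * s)" using less s(2) by simp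
      have ets: "0 < \<epsilon> * (t * s)" "\<epsilon> * (t * s) \<le> t * s" using \<epsilon> ts by (auto simp: mult_left_le_one_le)
      have pm: "dist p m < R"
        using dist_triangle[of p m x'] px' m' d' ts sR ets by (simp add: algebra_simps)
      let ?Bx = "ball x s" and ?By = "ball y s" and ?Cx = "ball x' (t * s)" and ?Cy = "ball y' (t * s)"
        and ?D = "ball m (\<epsilon> * (t * s))"
      have sub: "?Bx \<subseteq> ball p \<rho>" "?By \<subseteq> ball p \<rho>" "?Cx \<subseteq> ball p \<rho>" "?Cy \<subseteq> ball p \<rho>"
        using x y px' sR ts R by (auto intro!: ball_subset)
      have D: "?D \<subseteq> ?Cx \<inter> ?Cy"
        using m' d' by (intro Int_greatest ball_subset_triangle) (auto simp: algebra_simps dist_commute)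
      have disj: "?Bx \<inter> ?By = {}"
      proof (rule ccontr)
        assume "?Bx \<inter> ?By \<noteq> {}"
        then obtain z where "dist x z < s" "dist y z < s" by auto
        then show False using dist_triangle[of x y z] s(2) by (simp add: dist_commute)
      qed
      have pt: "p \<in> ball p \<rho>" using radius_pos by simp
      \<comment> \<open>Contraction sends each ball of radius \<open>s\<close> into the
        corresponding ball of radius \<open>t * s\<close>, so their union is a Borel set containing
        the image.\<close>
      have "(1 - \<delta>) * t powr n * measure H (?Bx \<union> ?By) \<le> measure H (?Cx \<union> ?Cy)"
      proof (rule measure_mcp[OF pt])
        fix u w assume "u \<in> ?Bx \<union> ?By" and w: "intermediate p t u w"
        then have u: "u \<in> ball p \<rho>" "u \<in> ?Bx \<or> u \<in> ?By" using sub by auto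
        have xy: "x \<in> ball p \<rho>" "y \<in> ball p \<rho>" using x y R by auto
        have *: "v \<in> ball z s \<longrightarrow> w' \<in> ball z' (t * s)" if "z \<in> ball p \<rho>" "v \<in> ball p \<rho>" "intermediate p t z z'" "intermediate p t v w'" for z z' v w'
        proof
          assume "v \<in> ball z s"
          have "dist z' w' \<le> t * dist z v" using contraction[OF pt that(1,2) _ t(2) that(3,4)] t(1) by simp
          also have "\<dots> < t * s" using \<open>v \<in> ball z s\<close> t(1) by simp
          finally show "w' \<in> ball z' (t * s)" by simp
        qed
        show "w \<in> ?Cx \<union> ?Cy"
          using *[OF xy(1) u(1) x' w] *[OF xy(2) u(1) y' w] u(2) by auto
      qed (use sub t in auto)
      moreover have "measure H (?Bx \<union> ?By) = V x s + V y s"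
        unfolding V_def using sub disj by (intro measure_Un3[THEN trans]) (auto intro: fmeasurable_H)
      moreover have "measure H (?Cx \<union> ?Cy) = V x' (t * s) + V y' (t * s) - measure H (?Cx \<inter> ?Cy)"
        unfolding V_def using sub by (intro measure_Un3) (auto intro: fmeasurable_H)
      moreover have "V m (\<epsilon> * (t * s)) \<le> measure H (?Cx \<inter> ?Cy)"
        unfolding V_def using D sub by (intro measure_mono_fmeasurable) (auto intro!: fmeasurable_H)
      \<comment> \<open>Measured in units of \<open>P\<close>, the estimates below no longer depend
        on \<open>t\<close> or \<open>s\<close>.\<close>
      moreover define P where "P = \<theta> * (t * s) powr n"
      have "0 < (t * s) powr n" using ts(1) by (metis powr_gt_zero less_irrefl)
      then have "0 < P" using \<theta> by (simp add: P_def)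
      have tsn: "t powr n * s powr n = (t * s) powr n" using t s by (simp add: powr_mult)
      have "(1 - \<eta>) * (2 * ((1 - \<eta>) * P)) \<le> (1 - \<delta>) * t powr n * (V x s + V y s)"
      proof -
        have "2 * ((1 - \<eta>) * P) = t powr n * ((1 - \<eta>) * \<theta> * s powr n + (1 - \<eta>) * \<theta> * s powr n)"
          unfolding P_def tsn[symmetric] by simp
        also have "\<dots> \<le> t powr n * (V x s + V y s)"
          using x y sR s R by (intro mult_left_mono add_mono lo) auto
        finally have "2 * ((1 - \<eta>) * P) \<le> t powr n * (V x s + V y s)" .
        then have "(1 - \<eta>) * (2 * ((1 - \<eta>) * P)) \<le> (1 - \<delta>) * (t powr n * (V x s + V y s))"
          using \<eta> \<delta> \<open>0 < P\<close> by (intro mult_mono[of "1 - \<eta>" "1 - \<delta>"]) auto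
        then show ?thesis by (simp only: mult.assoc)
      qed
      moreover have "V x' (t * s) \<le> (1 + \<eta>) * P" "V y' (t * s) \<le> (1 + \<eta>) * P"
        using up[of x' "t * s"] up[of y' "t * s"] px' sR ts R by (auto simp: P_def mult.assoc)
      \<comment> \<open>This is where \<open>\<epsilon> powr n = 24 * \<eta>\<close> enters, as the
        relative volume of the common ball.\<close>
      moreover have "(1 - \<eta>) * (24 * \<eta> * P) \<le> V m (\<epsilon> * (t * s))"
      proof -
        have "(1 - \<eta>) * (24 * \<eta> * P) = (1 - \<eta>) * \<theta> * (\<epsilon> * (t * s)) powr n"
          using \<epsilon> ts by (simp add: P_def \<eta>_def powr_mult)
        also have "\<dots> \<le> V m (\<epsilon> * (t * s))" using pm ets ts sR R by (intro lo) auto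
        finally show ?thesis .
      qed
      ultimately have "(1 - \<eta>) * (2 * ((1 - \<eta>) * P)) \<le> 2 * ((1 + \<eta>) * P) - (1 - \<eta>) * (24 * \<eta> * P)"
        by simp
      then have "((1 - \<eta>) * (2 * (1 - \<eta>)) + (1 - \<eta>) * (24 * \<eta>)) * P \<le> (2 * (1 + \<eta>)) * P"
        by (simp add: algebra_simps)
      then have "(1 - \<eta>) * (2 * (1 - \<eta>)) + (1 - \<eta>) * (24 * \<eta>) \<le> 2 * (1 + \<eta>)"
        using \<open>0 < P\<close> by (simp only: mult_le_cancel_right_pos)
      \<comment> \<open>A linear term is bounded by a quadratic one, which is impossible for
        positive \<open>\<eta> \<le> 1/24\<close>.\<close>
      then have "18 * \<eta> \<le> 22 * (\<eta> * \<eta>)" by (simp add: algebra_simps)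
      moreover have "\<eta> * \<eta> \<le> 1/24 * \<eta>" using \<eta> by (intro mult_right_mono) auto
      ultimately show False using \<eta> by linarith
    qed
  qed
qed

end

section \<open>The tangent cone\<close>

text \<open>The limit is the infimum over \<open>{0<..t0}\<close>.\<close>

lemma mono_tendsto_at_right:
  fixes f :: "real \<Rightarrow> real"
  assumes "0 < t0" and mono: "\<And>s t. 0 < s \<Longrightarrow> s \<le> t \<Longrightarrow> t \<le> t0 \<Longrightarrow> f s \<le> f t"
    and nonneg: "\<And>t. 0 < t \<Longrightarrow> t \<le> t0 \<Longrightarrow> 0 \<le> f t"
  shows "\<exists>l. (f \<longlongrightarrow> l) (at_right 0)"
proof (intro exI order_tendstoI)
  let ?F = "f ` {0<..t0}"
  have bdd: "bdd_below ?F" using nonneg by (auto intro!: bdd_belowI[of _ 0])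
  fix a
  show "\<forall>\<^sub>F s in at_right 0. a < f s" if "a < Inf ?F"
    unfolding eventually_at_right_field
  proof (intro exI[of _ t0] conjI allI impI)
    fix s assume "0 < s" "s < t0"
    then have "Inf ?F \<le> f s" using bdd by (intro cInf_lower) auto
    then show "a < f s" using that by simp
  qed fact
  show "\<forall>\<^sub>F s in at_right 0. f s < a" if inf: "Inf ?F < a"
  proof -
    have "?F \<noteq> {}" using \<open>0 < t0\<close> by auto
    then obtain t where t: "0 < t" "t \<le> t0" "f t < a" using cInf_lessD[OF _ inf] by auto
    have "f s < a" if "0 < s" "s < t" for s using mono[of s t] that t by simp
    then show ?thesis unfolding eventually_at_right_field using t(1) by blast
  qed
qed

lemma asymptotic_rel_class_eq:
  fixes d :: "'b \<Rightarrow> 'b \<Rightarrow> real"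
  assumes d: "\<And>x. x \<in> S \<Longrightarrow> d x x = 0" "\<And>x y. x \<in> S \<Longrightarrow> y \<in> S \<Longrightarrow> d x y = d y x"
    "\<And>x y z. x \<in> S \<Longrightarrow> y \<in> S \<Longrightarrow> z \<in> S \<Longrightarrow> d x z \<le> d x y + d y z"
    and uv: "(u, v) \<in> asymptotic_rel S d"
  shows "asymptotic_rel S d `` {u} = asymptotic_rel S d `` {v}"
proof -
  have in_S: "w i \<in> S" if "w \<in> cauchy_seqs S d" for w i
    using that by (auto simp: cauchy_seqs_def)
  have nn: "0 \<le> d x y" if "x \<in> S" "y \<in> S" for x y
    using d(1)[of x] d(2)[of x y] d(3)[of x y x] that by simp
  have sym: "(w, v) \<in> asymptotic_rel S d" if "(v, w) \<in> asymptotic_rel S d" for v w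
  proof -
    have "d (v i) (w i) = d (w i) (v i)" for i
      using that by (intro d(2) in_S) (auto simp: asymptotic_rel_def)
    then show ?thesis using that by (simp add: asymptotic_rel_def)
  qed
  have trans: "(u, w) \<in> asymptotic_rel S d" if "(u, v) \<in> asymptotic_rel S d" "(v, w) \<in> asymptotic_rel S d" for u v w
  proof -
    have *: "u \<in> cauchy_seqs S d" "v \<in> cauchy_seqs S d" "w \<in> cauchy_seqs S d"
      "(\<lambda>i. d (u i) (v i)) \<longlonglongrightarrow> 0" "(\<lambda>i. d (v i) (w i)) \<longlonglongrightarrow> 0"
      using that by (auto simp: asymptotic_rel_def)
    have "(\<lambda>i. d (u i) (w i)) \<longlonglongrightarrow> 0"
    proof (rule tendsto_sandwich[OF _ _ tendsto_const])
      show "(\<lambda>i. d (u i) (v i) + d (v i) (w i)) \<longlonglongrightarrow> 0" using tendsto_add[OF *(4,5)] by simp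
    qed (use nn d(3) in_S *(1-3) in \<open>auto intro!: always_eventually\<close>)
    then show ?thesis using * by (simp add: asymptotic_rel_def)
  qed
  show ?thesis using uv sym trans by blast
qed

text \<open>What is kept of topology and measure: extension to length \<open>L\<close> and a lower
  bound for contractions that is uniform in \<open>t\<close>. With the Busemann inequality of the
  parent locale, these are the data for comparing the cone with the space.\<close>

locale exp_ball = contracting_ball p \<rho> for p :: "'a::metric_space" and \<rho> :: real +
  fixes L \<epsilon> :: real
  assumes L: "0 < L" "L < \<rho>" and \<epsilon>: "0 < \<epsilon>" "\<epsilon> < 1"
    and nontrivial: "\<exists>x. x \<noteq> p"
    and extends: "\<And>x. x \<noteq> p \<Longrightarrow> dist p x \<le> L \<Longrightarrow> \<exists>z. lies_between p x z \<and> dist p z = L"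
    and lower: "\<And>x y x' y' t. x \<in> ball p L \<Longrightarrow> y \<in> ball p L \<Longrightarrow> 0 < t \<Longrightarrow> t \<le> 1 \<Longrightarrow> intermediate p t x x' \<Longrightarrow> intermediate p t y y'
      \<Longrightarrow> (1 - \<epsilon>) * (t * dist x y) \<le> dist x' y'"
begin

abbreviation "\<Gamma> \<equiv> shortest_paths_from p"

lemma path_intermediate:
  assumes "(l, \<gamma>) \<in> \<Gamma>" "0 \<le> a" "a \<le> l" "0 \<le> s" "s \<le> 1"
  shows "intermediate p s (\<gamma> a) (\<gamma> (s * a))"
  using shortest_path_intermediate[of UNIV l \<gamma> a s] assms by (auto simp: shortest_paths_from_def)

lemma path_dist: "(l, \<gamma>) \<in> \<Gamma> \<Longrightarrow> 0 \<le> a \<Longrightarrow> a \<le> l \<Longrightarrow> dist p (\<gamma> a) = a"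
  using shortest_path_dist[of UNIV l \<gamma> a] by (auto simp: shortest_paths_from_def)

lemma path_0: "(l, \<gamma>) \<in> \<Gamma> \<Longrightarrow> \<gamma> 0 = p"
  by (simp add: shortest_paths_from_def)

lemma path_length: "(l, \<gamma>) \<in> \<Gamma> \<Longrightarrow> 0 < l"
  by (simp add: shortest_paths_from_def)

text \<open>For small \<open>t\<close> the rescaled parameters \<open>a * t\<close> and
  \<open>b * t\<close> lie in the domains of both paths; the \<open>+ 1\<close> in the witness
  allows \<open>a = 0\<close> or \<open>b = 0\<close>.\<close>

lemma small_times:
  assumes "0 < l" "0 \<le> a" "0 \<le> b" "0 < l'"
  shows "\<exists>t0>0. \<forall>t. 0 < t \<longrightarrow> t \<le> t0 \<longrightarrow> a * t \<le> l \<and> b * t \<le> (l' :: real)"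
proof (intro exI conjI allI impI)
  show "0 < min (l / (a + 1)) (l' / (b + 1))" using assms by simp
  fix t assume t: "0 < t" "t \<le> min (l / (a + 1)) (l' / (b + 1))"
  have "(a + 1) * t \<le> l" "(b + 1) * t \<le> l'"
    using t assms by (auto simp: field_simps)
  then show "a * t \<le> l" "b * t \<le> l'" using t by (auto simp: algebra_simps)
qed

text \<open>Contraction by \<open>s / t\<close> shows that the difference quotient is nondecreasing
  in \<open>t\<close>, so \<open>Lim\<close> denotes an actual limit.\<close>

lemma pdist_tendsto:
  assumes g: "(l, \<gamma>) \<in> \<Gamma>" and h: "(l', \<eta>) \<in> \<Gamma>" and ab: "0 \<le> a" "0 \<le> b"
  shows "((\<lambda>t. dist (\<gamma> (a * t)) (\<eta> (b * t)) / t) \<longlongrightarrow> cone_pdist ((l, \<gamma>), a) ((l', \<eta>), b)) (at_right 0)"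
proof -
  let ?f = "\<lambda>t. dist (\<gamma> (a * t)) (\<eta> (b * t)) / t"
  obtain t0 where t0: "0 < t0" "\<And>t. 0 < t \<Longrightarrow> t \<le> t0 \<Longrightarrow> a * t \<le> min l (\<rho>/2) \<and> b * t \<le> min l' (\<rho>/2)"
    using small_times[of "min l (\<rho>/2)" a b "min l' (\<rho>/2)"] path_length[OF g] path_length[OF h] ab radius_pos
    by auto
  have "\<exists>r. (?f \<longlongrightarrow> r) (at_right 0)"
  proof (rule mono_tendsto_at_right[OF t0(1)])
    fix s t :: real assume st: "0 < s" "s \<le> t" "t \<le> t0"
    have t: "a * t \<le> l" "a * t < \<rho>" "b * t \<le> l'" "b * t < \<rho>" "0 \<le> a * t" "0 \<le> b * t"
      using t0(2)[of t] st ab radius_pos by auto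
    have st': "s / t * (a * t) = a * s" "s / t * (b * t) = b * s" "0 \<le> s / t" "s / t \<le> 1" using st by auto
    have "intermediate p (s / t) (\<gamma> (a * t)) (\<gamma> (a * s))" "intermediate p (s / t) (\<eta> (b * t)) (\<eta> (b * s))"
      using path_intermediate[OF g t(5,1) st'(3,4)] path_intermediate[OF h t(6,3) st'(3,4)] st'(1,2) by simp_all
    then have "dist (\<gamma> (a * s)) (\<eta> (b * s)) \<le> s / t * dist (\<gamma> (a * t)) (\<eta> (b * t))"
      using t st' radius_pos by (intro contraction[of p]) (auto simp: path_dist[OF g] path_dist[OF h])
    then show "?f s \<le> ?f t" using st by (simp add: field_simps)
  qed auto
  then obtain r where r: "(?f \<longlongrightarrow> r) (at_right 0)" ..
  then have "cone_pdist ((l, \<gamma>), a) ((l', \<eta>), b) = r"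
    unfolding cone_pdist_def by (simp add: tendsto_Lim)
  with r show ?thesis by simp
qed

text \<open>Both bounds hold for the quotient at every positive \<open>t \<le> 1\<close>, the upper
  one by the Busemann inequality and the other by \<open>lower\<close>, with constants free of
  \<open>t\<close>; hence they pass to the limit.\<close>

lemma pdist_le_dist:
  assumes g: "(l, \<gamma>) \<in> \<Gamma>" "0 \<le> a" "a \<le> l" "a < L" and h: "(l', \<eta>) \<in> \<Gamma>" "0 \<le> b" "b \<le> l'" "b < L"
  shows "cone_pdist ((l, \<gamma>), a) ((l', \<eta>), b) \<le> dist (\<gamma> a) (\<eta> b)"
    and "(1 - \<epsilon>) * dist (\<gamma> a) (\<eta> b) \<le> cone_pdist ((l, \<gamma>), a) ((l', \<eta>), b)"
proof -
  have lim: "((\<lambda>t. dist (\<gamma> (a * t)) (\<eta> (b * t)) / t) \<longlongrightarrow> cone_pdist ((l, \<gamma>), a) ((l', \<eta>), b)) (at_right 0)"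
    using g h by (intro pdist_tendsto)
  have ev: "\<forall>\<^sub>F t in at_right 0. 0 < t \<and> t \<le> (1::real)"
    unfolding eventually_at_right_field by (intro exI[of _ 1]) auto
  have t: "dist (\<gamma> (a * t)) (\<eta> (b * t)) / t \<le> dist (\<gamma> a) (\<eta> b) \<and>
      (1 - \<epsilon>) * dist (\<gamma> a) (\<eta> b) \<le> dist (\<gamma> (a * t)) (\<eta> (b * t)) / t" if "0 < t \<and> t \<le> 1" for t
  proof -
    have im: "intermediate p t (\<gamma> a) (\<gamma> (a * t))" "intermediate p t (\<eta> b) (\<eta> (b * t))"
      using path_intermediate[of l \<gamma> a t] path_intermediate[of l' \<eta> b t] g h that by (simp_all add: mult.commute)
    have in_ball: "\<gamma> a \<in> ball p L" "\<eta> b \<in> ball p L" using path_dist g h by auto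
    have "dist (\<gamma> (a * t)) (\<eta> (b * t)) \<le> t * dist (\<gamma> a) (\<eta> b)"
      using in_ball L that radius_pos by (intro contraction[OF _ _ _ _ _ im]) auto
    moreover have "(1 - \<epsilon>) * (t * dist (\<gamma> a) (\<eta> b)) \<le> dist (\<gamma> (a * t)) (\<eta> (b * t))"
      using that by (intro lower[OF in_ball _ _ im]) auto
    ultimately show ?thesis using that by (simp add: field_simps)
  qed
  show "cone_pdist ((l, \<gamma>), a) ((l', \<eta>), b) \<le> dist (\<gamma> a) (\<eta> b)"
    by (rule tendsto_upperbound[OF lim]) (use ev t in \<open>auto elim!: eventually_mono\<close>)
  show "(1 - \<epsilon>) * dist (\<gamma> a) (\<eta> b) \<le> cone_pdist ((l, \<gamma>), a) ((l', \<eta>), b)"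
    by (rule tendsto_lowerbound[OF lim]) (use ev t in \<open>auto elim!: eventually_mono\<close>)
qed

section \<open>The cone pseudo-metric\<close>

abbreviation "S \<equiv> cone_base p"

lemma pdist_refl: "x \<in> S \<Longrightarrow> cone_pdist x x = 0"
  by (auto simp: cone_pdist_def tendsto_Lim split: prod.splits)

lemma pdist_sym: "cone_pdist x y = cone_pdist y x"
  by (simp add: cone_pdist_def dist_commute split: prod.splits)

lemma pdist_triangle:
  assumes "x \<in> S" "y \<in> S" "z \<in> S"
  shows "cone_pdist x z \<le> cone_pdist x y + cone_pdist y z"
proof -
  obtain l1 g1 a1 l2 g2 a2 l3 g3 a3 where
    xyz: "x = ((l1, g1), a1)" "y = ((l2, g2), a2)" "z = ((l3, g3), a3)"
    by (metis prod.exhaust)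
  have *: "(l1, g1) \<in> \<Gamma>" "(l2, g2) \<in> \<Gamma>" "(l3, g3) \<in> \<Gamma>" "0 \<le> a1" "0 \<le> a2" "0 \<le> a3"
    using assms by (auto simp: cone_base_def xyz)
  show ?thesis
    unfolding xyz
  proof (rule tendsto_le[OF trivial_limit_at_right_real])
    show "((\<lambda>t. dist (g1 (a1 * t)) (g2 (a2 * t)) / t + dist (g2 (a2 * t)) (g3 (a3 * t)) / t) \<longlongrightarrow>
      cone_pdist ((l1, g1), a1) ((l2, g2), a2) + cone_pdist ((l2, g2), a2) ((l3, g3), a3)) (at_right 0)"
      using * by (intro tendsto_add pdist_tendsto)
    show "((\<lambda>t. dist (g1 (a1 * t)) (g3 (a3 * t)) / t) \<longlongrightarrow> cone_pdist ((l1, g1), a1) ((l3, g3), a3)) (at_right 0)"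
      using * by (intro pdist_tendsto)
    show "\<forall>\<^sub>F t in at_right 0. dist (g1 (a1 * t)) (g3 (a3 * t)) / t \<le>
        dist (g1 (a1 * t)) (g2 (a2 * t)) / t + dist (g2 (a2 * t)) (g3 (a3 * t)) / t"
      unfolding eventually_at_right_field
      by (intro exI[of _ 1]) (auto simp: add_divide_distrib[symmetric] intro!: divide_right_mono dist_triangle)
  qed
qed

lemma pdist_nonneg: "x \<in> S \<Longrightarrow> y \<in> S \<Longrightarrow> 0 \<le> cone_pdist x y"
  using pdist_triangle[of x y x] pdist_refl[of x] pdist_sym[of x y] by simp

text \<open>Only the germ of a path at 0 enters the limit; this allows a path to be replaced by one
  of another length.\<close>

lemma pdist_germ:
  assumes "(l, \<gamma>) \<in> \<Gamma>" "(l', \<eta>) \<in> \<Gamma>" "0 \<le> a" "0 < m" "\<And>t. 0 \<le> t \<Longrightarrow> t \<le> m \<Longrightarrow> \<gamma> t = \<eta> t"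
  shows "cone_pdist ((l, \<gamma>), a) ((l', \<eta>), a) = 0"
proof -
  obtain t0 where t0: "0 < t0" "\<And>t. 0 < t \<Longrightarrow> t \<le> t0 \<Longrightarrow> a * t \<le> m"
    using small_times[of m a a m] assms by auto
  have "\<forall>\<^sub>F t in at_right 0. 0 = dist (\<gamma> (a * t)) (\<eta> (a * t)) / t"
    unfolding eventually_at_right_field using t0 assms(3,5) by (intro exI[of _ t0]) auto
  then have "((\<lambda>t. dist (\<gamma> (a * t)) (\<eta> (a * t)) / t) \<longlongrightarrow> 0) (at_right 0)"
    by (rule Lim_transform_eventually[OF tendsto_const])
  then show ?thesis
    using pdist_tendsto[OF assms(1,2,3,3)] tendsto_unique[OF trivial_limit_at_right_real] by blast
qed

lemma pdist_apex:
  assumes "(l, \<gamma>) \<in> \<Gamma>" "(l', \<eta>) \<in> \<Gamma>" "0 \<le> b"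
  shows "cone_pdist ((l, \<gamma>), 0) ((l', \<eta>), b) = b"
proof -
  obtain t0 where t0: "0 < t0" "\<And>t. 0 < t \<Longrightarrow> t \<le> t0 \<Longrightarrow> b * t \<le> l'"
    using small_times[of l' b b l'] assms path_length by auto
  have "\<forall>\<^sub>F t in at_right 0. b = dist (\<gamma> (0 * t)) (\<eta> (b * t)) / t"
    unfolding eventually_at_right_field using t0 assms
    by (intro exI[of _ t0]) (auto simp: path_0 path_dist)
  then have "((\<lambda>t. dist (\<gamma> (0 * t)) (\<eta> (b * t)) / t) \<longlongrightarrow> b) (at_right 0)"
    by (rule Lim_transform_eventually[OF tendsto_const])
  then show ?thesis
    using pdist_tendsto[OF assms(1,2) order_refl assms(3)] tendsto_unique[OF trivial_limit_at_right_real] by blast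
qed

text \<open>The path is the contraction to \<open>p\<close> of a point at distance \<open>L\<close>
  beyond \<open>x\<close>. The clause on intermediate points says that it runs over every shortest
  path to \<open>x\<close>: \<open>s = 1\<close> gives the end point in \<open>path_to\<close>, and
  all \<open>s\<close> together give equality of germs in \<open>path_normal_form\<close>.\<close>

lemma path_through:
  assumes "x \<noteq> p" "dist p x \<le> L"
  shows "\<exists>\<gamma>. (L, \<gamma>) \<in> \<Gamma> \<and> (\<forall>s\<in>{0..1}. \<forall>w. intermediate p s x w \<longrightarrow> \<gamma> (s * dist p x) = w)"
proof -
  obtain z where z: "lies_between p x z" "dist p z = L" using extends assms by blast
  have zb: "p \<in> ball p \<rho>" "z \<in> ball p \<rho>" "p \<noteq> z" using z L radius_pos by auto
  define \<gamma> where "\<gamma> s = contract p (s / L) z" for s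
  have "(L, \<gamma>) \<in> \<Gamma>"
    unfolding shortest_paths_from_def shortest_path_def
  proof (clarsimp, intro conjI ballI)
    show "\<gamma> 0 = p" unfolding \<gamma>_def using contract_intermediate[of 0 p z] by (simp add: intermediate_0)
    fix s t assume "s \<in> {0..L}" "t \<in> {0..L}"
    then have "dist (\<gamma> s) (\<gamma> t) = \<bar>s / L - t / L\<bar> * L"
      unfolding \<gamma>_def using L zb by (subst dist_contract_contract) (auto simp: z(2))
    also have "\<dots> = \<bar>s - t\<bar>" using L by (simp add: diff_divide_distrib[symmetric])
    finally show "dist (\<gamma> s) (\<gamma> t) = \<bar>s - t\<bar>" .
  qed (use L in auto)
  moreover have "\<gamma> (s * dist p x) = w" if "s \<in> {0..1}" "intermediate p s x w" for s w
  proof -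
    have "intermediate p (dist p x / L) z x" using lies_between_imp_intermediate[OF z(1) zb(3)] z(2) by simp
    from intermediate_trans[OF this that(2)] have "intermediate p (s * dist p x / L) z w" by simp
    moreover have "s * dist p x \<le> L" using that(1) assms(2) L
      by (metis atLeastAtMost_iff mult_left_le_one_le order_trans zero_le_dist)
    ultimately show ?thesis unfolding \<gamma>_def using that(1) L zb by (intro contract_eq) auto
  qed
  ultimately show ?thesis by blast
qed

lemma path_to:
  assumes "dist p x \<le> L"
  shows "\<exists>\<gamma>. (L, \<gamma>) \<in> \<Gamma> \<and> \<gamma> (dist p x) = x"
proof (cases "x = p")
  case False
  then show ?thesis using path_through[OF False assms] intermediate_1[of p x x] by (metis atLeastAtMost_iff mult_1 order_refl zero_le_one)
next
  case True
  \<comment> \<open>Any path from \<open>p\<close> will do here, but one must exist;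
    \<open>s\<close> brings another point within distance \<open>L\<close>.\<close>
  obtain y where "y \<noteq> p" using nontrivial by blast
  define s where "s = min 1 (L / dist p y)"
  have s: "0 < s" "s \<le> 1" using L \<open>y \<noteq> p\<close> by (auto simp: s_def)
  then obtain w where w: "intermediate p s y w" using intermediate_exists[of s p y] by auto
  have "s * dist p y \<le> L / dist p y * dist p y" unfolding s_def by (intro mult_right_mono) auto
  then have "dist p w \<le> L" "w \<noteq> p" using w s \<open>y \<noteq> p\<close> by (auto simp: intermediate_def)
  then show ?thesis using path_through[of w] path_0 True by auto
qed

text \<open>Paths in a Cauchy sequence of the cone may be too short to be evaluated at their
  parameter \<open>a\<close>. A path of length \<open>L\<close> with the same germ represents the
  same cone point and can be evaluated whenever \<open>a \<le> L\<close>.\<close>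

lemma path_normal_form:
  assumes "(l, \<gamma>) \<in> \<Gamma>"
  shows "\<exists>\<eta>. (L, \<eta>) \<in> \<Gamma> \<and> (\<forall>a\<ge>0. cone_pdist ((l, \<gamma>), a) ((L, \<eta>), a) = 0)"
proof -
  define m where "m = min l L"
  have m: "0 < m" "m \<le> l" "m \<le> L" using L path_length[OF assms] by (auto simp: m_def)
  have d: "dist p (\<gamma> m) = m" using m by (intro path_dist[OF assms]) auto
  then have "\<gamma> m \<noteq> p" using m by auto
  then obtain \<eta> where \<eta>: "(L, \<eta>) \<in> \<Gamma>" "\<And>s w. s \<in> {0..1} \<Longrightarrow> intermediate p s (\<gamma> m) w \<Longrightarrow> \<eta> (s * m) = w"
    using path_through[of "\<gamma> m"] d m by auto
  have "\<gamma> t = \<eta> t" if "0 \<le> t" "t \<le> m" for t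
  proof -
    have "intermediate p (t / m) (\<gamma> m) (\<gamma> (t / m * m))" using that m by (intro path_intermediate[OF assms]) auto
    then show ?thesis using \<eta>(2)[of "t / m"] that m by simp
  qed
  then show ?thesis using pdist_germ[OF assms \<eta>(1) _ m(1)] \<eta>(1) by blast
qed

section \<open>Points of the completed cone\<close>

lemma Gamma_nonempty: "\<exists>g. g \<in> \<Gamma>"
  using path_to[of p] L by auto

lemmas pseudometric = pdist_refl pdist_sym pdist_triangle

lemma const_cauchy: "x \<in> S \<Longrightarrow> (\<lambda>_. x) \<in> cauchy_seqs S cone_pdist"
  by (auto simp: cauchy_seqs_def pdist_refl)

lemma cone_dist_lim:
  assumes "x \<in> S" "u \<in> cauchy_seqs S cone_pdist"
  shows "(\<lambda>i. cone_pdist x (u i)) \<longlonglongrightarrow>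
    cone_dist (completion_point S cone_pdist x) (asymptotic_rel S cone_pdist `` {u})"
  unfolding cone_dist_def completion_point_def
  using completion_dist_eq[OF pseudometric const_cauchy[OF assms(1)] assms(2)] by simp

lemma cone_dist_class:
  assumes "g \<in> \<Gamma>" "h \<in> \<Gamma>" "0 \<le> a" "0 \<le> b"
  shows "cone_dist (cone_class p g a) (cone_class p h b) = cone_pdist (g, a) (h, b)"
proof -
  have "(g, a) \<in> S" "(h, b) \<in> S" using assms by (auto simp: cone_base_def)
  from cone_dist_lim[OF this(1) const_cauchy[OF this(2)]] show ?thesis
    unfolding cone_class_def completion_point_def[of S cone_pdist "(h, b)"] by (simp add: LIMSEQ_const_iff)
qed

lemma class_eqI:
  assumes "u \<in> cauchy_seqs S cone_pdist" "x \<in> S" "(\<lambda>i. cone_pdist (u i) x) \<longlonglongrightarrow> 0"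
  shows "asymptotic_rel S cone_pdist `` {u} = completion_point S cone_pdist x"
  unfolding completion_point_def
  using assms const_cauchy by (intro asymptotic_rel_class_eq[OF pseudometric]) (auto simp: asymptotic_rel_def)

lemma cone_class_eqI:
  assumes "g \<in> \<Gamma>" "h \<in> \<Gamma>" "0 \<le> a" "0 \<le> b" "cone_pdist (g, a) (h, b) = 0"
  shows "cone_class p g a = cone_class p h b"
proof -
  have "(g, a) \<in> S" "(h, b) \<in> S" using assms by (auto simp: cone_base_def)
  then show ?thesis
    using class_eqI[OF const_cauchy, of "(g, a)" "(h, b)"] assms(5)
    unfolding cone_class_def completion_point_def[of S cone_pdist "(g, a)"] by simp
qed

text \<open>Any two paths at parameter 0 are at cone distance 0, so the description in
  \<open>cone_apex\<close> fits exactly one class.\<close>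

lemma cone_apex_eq:
  assumes "g \<in> \<Gamma>"
  shows "cone_apex p = cone_class p g 0"
  unfolding cone_apex_def
proof (rule the_equality)
  show "\<exists>h\<in>\<Gamma>. cone_class p g 0 = cone_class p h 0" using assms by blast
  fix v assume "\<exists>g\<in>\<Gamma>. v = cone_class p g 0"
  then obtain h where h: "h \<in> \<Gamma>" "v = cone_class p h 0" by blast
  have "cone_pdist (h, 0) (g, 0) = 0"
    using pdist_apex[of "fst h" "snd h" "fst g" "snd g" 0] h assms by simp
  then show "v = cone_class p g 0" unfolding h(2) using h(1) assms by (intro cone_class_eqI) auto
qed

lemma cone_dist_apex:
  assumes "(l, \<gamma>) \<in> \<Gamma>" "0 \<le> a"
  shows "cone_dist (cone_apex p) (cone_class p (l, \<gamma>) a) = a"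
  using cone_dist_class[OF assms(1,1) order_refl assms(2)] pdist_apex[OF assms(1,1,2)]
  by (simp add: cone_apex_eq[OF assms(1)])

lemma cone_class_in_tangent_cone:
  assumes "g \<in> \<Gamma>" "0 \<le> a"
  shows "cone_class p g a \<in> tangent_cone p"
proof -
  have "(g, a) \<in> S" using assms by (simp add: cone_base_def)
  then show ?thesis
    unfolding tangent_cone_def completion_def cone_class_def completion_point_def
    by (intro quotientI const_cauchy)
qed

text \<open>Completion adds nothing inside radius \<open>L\<close>. By the lower bound in
  \<open>pdist_le_dist\<close>, a Cauchy sequence of the cone gives a Cauchy sequence of end points
  in the complete ambient space; by the upper bound, the path to their limit represents the given
  class.\<close>

lemma cone_ball_representation:
  assumes v: "v \<in> cone_ball p L"
  obtains \<gamma> a where "(L, \<gamma>) \<in> \<Gamma>" "0 \<le> a" "a < L" "v = cone_class p (L, \<gamma>) a"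
proof -
  obtain u where u: "u \<in> cauchy_seqs S cone_pdist" "v = asymptotic_rel S cone_pdist `` {u}"
    using v by (auto simp: cone_ball_def tangent_cone_def completion_def elim: quotientE)
  define a where "a i = snd (u i)" for i
  define r where "r = cone_dist (cone_apex p) v"
  have "r < L" using v by (simp add: cone_ball_def r_def)
  have uS: "u i \<in> S" for i using u(1) by (auto simp: cauchy_seqs_def)
  have a0: "0 \<le> a i" for i using uS[of i] by (auto simp: cone_base_def a_def)
  have "\<exists>\<eta>. (L, \<eta>) \<in> \<Gamma> \<and> cone_pdist (u i) ((L, \<eta>), a i) = 0" for i
  proof -
    obtain l \<gamma> where "u i = ((l, \<gamma>), a i)" unfolding a_def by (metis prod.collapse)
    moreover then have "(l, \<gamma>) \<in> \<Gamma>" using uS[of i] by (simp add: cone_base_def)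
    ultimately show ?thesis using path_normal_form[of l \<gamma>] a0[of i] by auto
  qed
  then obtain \<eta> where \<eta>: "\<And>i. (L, \<eta> i) \<in> \<Gamma>" "\<And>i. cone_pdist (u i) ((L, \<eta> i), a i) = 0" by metis
  have \<eta>S: "((L, \<eta> i), a i) \<in> S" for i using \<eta>(1) a0 by (simp add: cone_base_def)
  obtain g where g: "g \<in> \<Gamma>" using Gamma_nonempty by blast
  have "cone_pdist (g, 0) (u i) = a i" for i
    using pdist_apex[of "fst g" "snd g" "fst (fst (u i))" "snd (fst (u i))" "a i"] g uS[of i] a0[of i]
    by (auto simp: cone_base_def a_def)
  moreover have "(g, 0) \<in> S" using g by (simp add: cone_base_def)
  \<comment> \<open>The parameters are the distances to the apex, so they are eventually below
    \<open>L\<close>, where end points exist and the comparison applies.\<close>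
  ultimately have ar: "a \<longlonglongrightarrow> r"
    using cone_dist_lim[OF _ u(1), of "(g, 0)"] by (simp add: r_def cone_apex_eq[OF g] cone_class_def u(2))
  have r0: "0 \<le> r" by (rule LIMSEQ_le_const[OF ar]) (use a0 in auto)
  obtain N where N: "\<And>i. i \<ge> N \<Longrightarrow> a i < L"
    using order_tendstoD(2)[OF ar \<open>r < L\<close>] by (auto simp: eventually_sequentially)
  define x where "x i = \<eta> i (a i)" for i
  have px: "dist p (x i) = a i" if "i \<ge> N" for i
    unfolding x_def using N[OF that] a0 by (intro path_dist[OF \<eta>(1)]) auto
  have near: "(1 - \<epsilon>) * dist (x i) (x j) \<le> cone_pdist (u i) (u j)" if "i \<ge> N" "j \<ge> N" for i j
  proof -
    have "(1 - \<epsilon>) * dist (x i) (x j) \<le> cone_pdist ((L, \<eta> i), a i) ((L, \<eta> j), a j)"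
      unfolding x_def using N[OF that(1)] N[OF that(2)] a0 by (intro pdist_le_dist(2) \<eta>) auto
    also have "\<dots> \<le> cone_pdist (u i) (u j)"
      using pdist_triangle[OF \<eta>S[of i] uS[of i] \<eta>S[of j]] pdist_triangle[OF uS[of i] uS[of j] \<eta>S[of j]]
        \<eta>(2)[of i] \<eta>(2)[of j] pdist_sym[of "u i" "((L, \<eta> i), a i)"] by simp
    finally show ?thesis .
  qed
  have "Cauchy x"
  proof (rule metric_CauchyI)
    fix e :: real assume "0 < e"
    then have e: "0 < (1 - \<epsilon>) * e" using \<epsilon> by simp
    have "\<forall>e>0. \<exists>N. \<forall>i\<ge>N. \<forall>j\<ge>N. cone_pdist (u i) (u j) < e" using u(1) by (simp add: cauchy_seqs_def)
    from this[rule_format, OF e]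
    obtain M where M: "\<forall>i\<ge>M. \<forall>j\<ge>M. cone_pdist (u i) (u j) < (1 - \<epsilon>) * e" ..
    show "\<exists>M. \<forall>i\<ge>M. \<forall>j\<ge>M. dist (x i) (x j) < e"
    proof (intro exI[of _ "max M N"] allI impI)
      fix i j assume "max M N \<le> i" "max M N \<le> j"
      then have "(1 - \<epsilon>) * dist (x i) (x j) < (1 - \<epsilon>) * e" using M near[of i j] by fastforce
      then show "dist (x i) (x j) < e" using \<epsilon> by simp
    qed
  qed
  then obtain y where y: "x \<longlonglongrightarrow> y" using complete_UNIV by (auto simp: complete_def)
  have "(\<lambda>i. dist p (x i)) \<longlonglongrightarrow> dist p y" by (intro tendsto_intros y)
  moreover have "\<forall>\<^sub>F i in sequentially. a i = dist p (x i)"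
    using eventually_ge_at_top[of N] by eventually_elim (simp add: px)
  then have "(\<lambda>i. dist p (x i)) \<longlonglongrightarrow> r" by (rule Lim_transform_eventually[OF ar])
  ultimately have yr: "dist p y = r" by (rule LIMSEQ_unique)
  then obtain \<gamma> where \<gamma>: "(L, \<gamma>) \<in> \<Gamma>" "\<gamma> r = y" using path_to[of y] \<open>r < L\<close> by auto
  have \<gamma>S: "((L, \<gamma>), r) \<in> S" using \<gamma> r0 by (simp add: cone_base_def)
  have "v = cone_class p (L, \<gamma>) r"
    unfolding u(2) cone_class_def
  proof (rule class_eqI[OF u(1) \<gamma>S])
    have "(\<lambda>i. dist (x i) y) \<longlonglongrightarrow> 0" using y by (rule tendsto_dist_iff[THEN iffD1])
    then show "(\<lambda>i. cone_pdist (u i) ((L, \<gamma>), r)) \<longlonglongrightarrow> 0"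
    proof (rule tendsto_sandwich[OF _ _ tendsto_const, rotated 2])
      show "\<forall>\<^sub>F i in sequentially. 0 \<le> cone_pdist (u i) ((L, \<gamma>), r)"
        using uS \<gamma>S pdist_nonneg by (auto intro!: always_eventually)
      show "\<forall>\<^sub>F i in sequentially. cone_pdist (u i) ((L, \<gamma>), r) \<le> dist (x i) y"
        using eventually_ge_at_top[of N]
      proof eventually_elim
        case (elim i)
        have "cone_pdist (u i) ((L, \<gamma>), r) \<le> cone_pdist ((L, \<eta> i), a i) ((L, \<gamma>), r)"
          using pdist_triangle[OF uS[of i] \<eta>S[of i] \<gamma>S] \<eta>(2)[of i] by simp
        also have "\<dots> \<le> dist (\<eta> i (a i)) (\<gamma> r)"
          using N[OF elim] a0 r0 \<open>r < L\<close> by (intro pdist_le_dist(1) \<eta> \<gamma>) auto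
        finally show ?case by (simp add: x_def \<gamma>(2))
      qed
    qed
  qed
  then show ?thesis using that \<gamma>(1) r0 \<open>r < L\<close> by blast
qed

text \<open>Representatives of one class have the same parameter, namely the distance to the apex,
  and are at cone distance 0; the lower bound then makes their end points coincide.\<close>

lemma exp_rel_unique:
  assumes v: "v \<in> cone_ball p L" and "exp_rel p v x" "exp_rel p v y"
  shows "x = y"
proof -
  obtain l \<gamma> a l' \<eta> b where
    g: "(l, \<gamma>) \<in> \<Gamma>" "0 \<le> a" "a \<le> l" "v = cone_class p (l, \<gamma>) a" "x = \<gamma> a" and
    h: "(l', \<eta>) \<in> \<Gamma>" "0 \<le> b" "b \<le> l'" "v = cone_class p (l', \<eta>) b" "y = \<eta> b"
    using assms(2,3) by (auto simp: exp_rel_def)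
  have "a < L" "b < L"
    using v cone_dist_apex[OF g(1,2)] cone_dist_apex[OF h(1,2)] g(4) h(4) by (simp_all add: cone_ball_def)
  then have "(1 - \<epsilon>) * dist x y \<le> cone_pdist ((l, \<gamma>), a) ((l', \<eta>), b)"
    using g h by (auto intro: pdist_le_dist(2))
  also have "\<dots> = cone_dist v v"
    using cone_dist_class[OF g(1) h(1) g(2) h(2)] g(4) h(4) by simp
  also have "\<dots> = cone_pdist ((l, \<gamma>), a) ((l, \<gamma>), a)"
    using cone_dist_class[OF g(1) g(1) g(2) g(2)] g(4) by simp
  also have "\<dots> = 0" using g by (intro pdist_refl) (simp add: cone_base_def)
  finally show ?thesis using \<epsilon> by (simp add: mult_le_0_iff)
qed

lemma exp_map_eq:
  assumes "(l, \<gamma>) \<in> \<Gamma>" "0 \<le> a" "a \<le> l" "a < L"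
  shows "exp_map p (cone_class p (l, \<gamma>) a) = \<gamma> a" "cone_class p (l, \<gamma>) a \<in> cone_ball p L"
proof -
  show v: "cone_class p (l, \<gamma>) a \<in> cone_ball p L"
    using assms by (simp add: cone_ball_def cone_class_in_tangent_cone cone_dist_apex)
  have "exp_rel p (cone_class p (l, \<gamma>) a) (\<gamma> a)" using assms by (auto simp: exp_rel_def)
  then show "exp_map p (cone_class p (l, \<gamma>) a) = \<gamma> a"
    unfolding exp_map_def using exp_rel_unique[OF v] by (intro the_equality) auto
qed

theorem exp_well_defined: "exp_well_defined p L"
  unfolding exp_well_defined_def
proof
  fix v assume v: "v \<in> cone_ball p L"
  then obtain \<gamma> a where "(L, \<gamma>) \<in> \<Gamma>" "0 \<le> a" "a < L" "v = cone_class p (L, \<gamma>) a"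
    by (rule cone_ball_representation)
  then have "exp_rel p v (\<gamma> a)" unfolding exp_rel_def using less_imp_le by blast
  then show "\<exists>!x. exp_rel p v x" using exp_rel_unique[OF v] by blast
qed

text \<open>The exponential map never shortens distances and stretches them by at most
  \<open>1 / (1 - \<epsilon>)\<close>; the hypothesis fits this one-sided range into the tolerance
  \<open>\<epsilon>'\<close>.\<close>

theorem exp_almost_isometry:
  assumes "1 / (1 - \<epsilon>) \<le> 1 + \<epsilon>'"
  shows "almost_isometry \<epsilon>' (cone_ball p L) cone_dist (ball p L) dist (exp_map p)"
  unfolding almost_isometry_def
proof (intro conjI ballI impI)
  have "\<exists>v\<in>cone_ball p L. exp_map p v = x" if x: "x \<in> ball p L" for x
  proof -
    obtain \<gamma> where "(L, \<gamma>) \<in> \<Gamma>" "\<gamma> (dist p x) = x" using path_to[of x] x unfolding mem_ball by (meson less_imp_le)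
    then show ?thesis using exp_map_eq[of L \<gamma> "dist p x"] x by auto
  qed
  moreover have "exp_map p v \<in> ball p L" if v: "v \<in> cone_ball p L" for v
  proof -
    obtain \<gamma> a where "(L, \<gamma>) \<in> \<Gamma>" "0 \<le> a" "a < L" "v = cone_class p (L, \<gamma>) a"
      using v by (rule cone_ball_representation)
    then show ?thesis using exp_map_eq[of L \<gamma> a] path_dist[of L \<gamma> a] by simp
  qed
  ultimately show "exp_map p ` cone_ball p L = ball p L" by force
  fix v w assume v: "v \<in> cone_ball p L" and w: "w \<in> cone_ball p L" and "v \<noteq> w"
  obtain \<gamma> a where g: "(L, \<gamma>) \<in> \<Gamma>" "0 \<le> a" "a < L" "v = cone_class p (L, \<gamma>) a"
    using v by (rule cone_ball_representation)
  obtain \<eta> b where h: "(L, \<eta>) \<in> \<Gamma>" "0 \<le> b" "b < L" "w = cone_class p (L, \<eta>) b"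
    using w by (rule cone_ball_representation)
  define D where "D = dist (\<gamma> a) (\<eta> b)"
  define E where "E = cone_dist v w"
  have E: "E = cone_pdist ((L, \<gamma>), a) ((L, \<eta>), b)"
    unfolding E_def using cone_dist_class[OF g(1) h(1) g(2) h(2)] g(4) h(4) by simp
  \<comment> \<open>Points at pseudo-distance 0 were identified in the completion, so distinct
    classes are at positive distance.\<close>
  have "E \<noteq> 0" using cone_class_eqI[OF g(1) h(1) g(2) h(2)] E \<open>v \<noteq> w\<close> g(4) h(4) by auto
  have "E \<le> D" "(1 - \<epsilon>) * D \<le> E"
    unfolding E D_def using g h by (auto intro: pdist_le_dist)
  have "0 \<le> D" by (simp add: D_def)
  then have "0 \<le> (1 - \<epsilon>) * D" using \<epsilon> by simp
  then have "0 < E" using \<open>E \<noteq> 0\<close> \<open>(1 - \<epsilon>) * D \<le> E\<close> by linarith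
  have "1 \<le> D / E" using \<open>E \<le> D\<close> \<open>0 < E\<close> by simp
  moreover have "D / E \<le> 1 / (1 - \<epsilon>)"
    using \<open>(1 - \<epsilon>) * D \<le> E\<close> \<open>0 < E\<close> \<epsilon> by (simp add: field_simps)
  ultimately have "\<bar>D / E - 1\<bar> \<le> \<epsilon>'" using assms by simp
  moreover have "exp_map p v = \<gamma> a" "exp_map p w = \<eta> b"
    using exp_map_eq(1)[of L \<gamma> a] exp_map_eq(1)[of L \<eta> b] g h by auto
  ultimately show "\<bar>dist (exp_map p v) (exp_map p w) / cone_dist v w - 1\<bar> \<le> \<epsilon>'"
    by (simp add: D_def E_def)
qed

end

section \<open>The exponential map at a manifold point\<close>

lemma geodesic_contraction_near_manifold_point:
  fixes K n \<epsilon> :: real and p :: "'a::metric_space"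
  assumes "K \<le> 0" and n: "1 \<le> n"
    and busemann: "locally_busemann_space TYPE('a)"
    and mcp: "local_noncollapsed_mcp TYPE('a) K n"
    and manifold: "manifold_point p"
    and \<epsilon>: "0 < \<epsilon>" "\<epsilon> < 1"
  shows "\<exists>\<rho> L. exp_ball p \<rho> L \<epsilon>"
proof -
  let ?H = "hausdorff_measure n :: 'a measure"
  have compl: "complete (UNIV :: 'a set)" and geo: "geodesic_space (UNIV :: 'a set)"
    using busemann by (simp_all add: locally_busemann_space_def)
  obtain W where W: "p \<in> interior W" "busemann_space W"
    using busemann unfolding locally_busemann_space_def by blast
  obtain U where U: "p \<in> interior U" "mcp K n (restrict_space ?H U)"
    using mcp unfolding local_noncollapsed_mcp_def local_mcp_def by blast
  obtain C k where C: "p \<in> interior C" "top_of_set C homeomorphic_space Euclidean_space k"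
    using manifold unfolding manifold_point_def by blast
  have "p \<in> interior (W \<inter> U \<inter> C)" using W U C by simp
  then obtain r1 where r1: "0 < r1" "ball p r1 \<subseteq> W" "ball p r1 \<subseteq> U" "ball p r1 \<subseteq> C"
    unfolding mem_interior by auto
  have mms: "metric_measure_space (restrict_space ?H U)" using U(2) by (simp add: mcp_def)
  obtain r2 where r2: "0 < r2" "emeasure ?H (ball p r2) < \<infinity>"
    using locally_finite_ball[OF sets_hausdorff_measure mms U(1)] by blast
  \<comment> \<open>The loss in measure contraction that \<open>contraction_almost_isometric\<close>
    tolerates.\<close>
  define \<delta> where "\<delta> = \<epsilon> powr n / 96"
  have "\<epsilon> powr n \<le> 1 powr n" using \<epsilon> n by (intro powr_mono2) auto
  then have \<delta>: "0 < \<delta>" "\<delta> < 1" using \<epsilon> by (auto simp: \<delta>_def)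
  obtain r3 where r3: "0 < r3" "K < 0 \<Longrightarrow> \<forall>t\<in>{0<..1}. \<forall>d\<in>{0..r3}. (1 - \<delta>) * t powr n \<le> mcp_factor K n t d"
    using mcp_factor_lower_bound[OF _ n \<delta>, of K] zero_less_one by metis
  \<comment> \<open>A third of \<open>r1\<close> keeps shortest paths between points of the ball
    inside all three neighbourhoods; half of \<open>r3\<close> suffices because such points are less
    than \<open>2 * \<rho>\<close> apart.\<close>
  define \<rho> where "\<rho> = min (r1 / 3) (min r2 (r3 / 2))"
  have \<rho>: "0 < \<rho>" "3 * \<rho> \<le> r1" "\<rho> \<le> r2" "2 * \<rho> \<le> r3" using r1 r2 r3 by (auto simp: \<rho>_def)
  have sub: "ball p (3 * \<rho>) \<subseteq> ball p r1" using \<rho> by (intro subset_ball)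
  interpret contracting_ball p \<rho>
    using compl geo W(2) sub r1(2) \<rho>(1) by (intro busemann_contracting_ball[of W]) auto
  interpret extensible_ball p \<rho>
  proof
    show "\<exists>y. y \<noteq> x \<and> lies_between q x y" if "q \<in> ball p \<rho>" "x \<in> ball p \<rho>" "q \<noteq> x" for q x
      using local_extension[OF C(2) _ that] sub r1(4) by blast
  qed
  have pos: "0 < emeasure ?H (ball p r)" if "0 < r" for r
    using locally_positive_ball[OF sets_hausdorff_measure mms _ that] U(1) interior_subset by blast
  interpret volume_ball p \<rho> n \<delta>
  proof
    show "emeasure ?H (ball p \<rho>) < \<infinity>"
      using r2(2) emeasure_mono[OF subset_ball[OF \<rho>(3)], of p ?H] by (auto intro: le_less_trans)
    show "ennreal ((1 - \<delta>) * t powr n) * emeasure ?H A \<le> emeasure ?H B"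
      if "q \<in> ball p \<rho>" "A \<in> sets borel" "A \<subseteq> ball p \<rho>" "B \<in> sets borel"
        "\<And>x z. x \<in> A \<Longrightarrow> intermediate q t x z \<Longrightarrow> z \<in> B" "0 < t" "t \<le> 1" "emeasure ?H A < \<infinity>" for q A B t
    proof (rule mcp_contraction_measure[OF sets_hausdorff_measure geo U(2)])
      show "ball p (3 * \<rho>) \<subseteq> U" using sub r1(3) by blast
      show "\<forall>t\<in>{0<..1}. \<forall>d\<in>{0..2 * \<rho>}. (1 - \<delta>) * t powr n \<le> mcp_factor K n t d" if "K < 0"
        using r3(2)[OF that] \<rho>(4) by auto
    qed (use that \<rho>(1) \<open>K \<le> 0\<close> \<delta> in auto)
  qed (use n \<delta> pos in auto)
  obtain L where L: "0 < L" "L \<le> \<rho> / 8"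
    and lower: "\<forall>x\<in>ball p L. \<forall>y\<in>ball p L. \<forall>x' y'. \<forall>t\<in>{0<..1}.
      intermediate p t x x' \<longrightarrow> intermediate p t y y' \<longrightarrow> (1 - \<epsilon>) * (t * dist x y) \<le> dist x' y'"
    using contraction_almost_isometric[of \<epsilon>] \<epsilon> by (auto simp: \<delta>_def)
  have "exp_ball p \<rho> L \<epsilon>"
  proof
    show "\<exists>x. x \<noteq> p"
    proof (rule ccontr)
      assume "\<not> ?thesis"
      then have "ball p 1 = {p}" by auto
      then have "emeasure ?H (ball p 1) = 0"
        by (simp add: emeasure_hausdorff_measure hausdorff_outer_singleton)
      then show False using pos[of 1] by simp
    qed
    show "\<exists>z. lies_between p x z \<and> dist p z = L" if "x \<noteq> p" "dist p x \<le> L" for x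
      using that L \<rho>(1) by (intro uniform_extension) auto
    show "(1 - \<epsilon>) * (t * dist x y) \<le> dist x' y'"
      if "x \<in> ball p L" "y \<in> ball p L" "0 < t" "t \<le> 1" "intermediate p t x x'" "intermediate p t y y'" for x y x' y' t
      using lower that by auto
  qed (use L \<epsilon> \<rho>(1) in auto)
  then show ?thesis by blast
qed

theorem theorem7p1:
  fixes K n \<epsilon> :: real and p :: "'a::metric_space"
  assumes "K \<le> 0" and "1 \<le> n"
    and "locally_busemann_space TYPE('a)"
    and "local_noncollapsed_mcp TYPE('a) K n"
    and "manifold_point p"
    and "0 < \<epsilon>" and "\<epsilon> < 1"
  shows "\<exists>R>0. exp_well_defined p R \<and>
           almost_isometry \<epsilon> (cone_ball p R) cone_dist (ball p R) dist (exp_map p)"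
proof -
  \<comment> \<open>Halving makes the stretching factor \<open>1 / (1 - \<epsilon> / 2)\<close> at
    most \<open>1 + \<epsilon>\<close>, because
    \<open>\<epsilon> * \<epsilon> \<le> \<epsilon>\<close>.\<close>
  obtain \<rho> L where "exp_ball p \<rho> L (\<epsilon> / 2)"
    using geodesic_contraction_near_manifold_point[OF assms(1-5), of "\<epsilon> / 2"] assms(6,7) by auto
  then interpret exp_ball p \<rho> L "\<epsilon> / 2" .
  have "\<epsilon> * \<epsilon> \<le> \<epsilon>" using assms(6,7) by (simp add: mult_left_le_one_le)
  then have "1 / (1 - \<epsilon> / 2) \<le> 1 + \<epsilon>" using assms(6,7) by (simp add: field_simps)
  then show ?thesis using L(1) exp_well_defined exp_almost_isometry by blast
qed

end
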